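(* Let $n\ge 1$ and $w\in S_n$. Then $w$ is spherical if and only if $w$ avoids each of the following twenty one patterns in $S_5$: \[ P=\{24531,25314,25341,34512,34521,35412,35421,42531,45123,45213,45231,45312,52314,52341,53124,53142,53412,53421,54123,54213,54231\}. \]
   Context: $S_n$ is the symmetric group, viewed as a Coxeter group with simple generators $I=\{s_1,\dots,s_{n-1}\}$, $s_i=(i\ i+1)$. The length $\ell(w)$ is the length of a shortest expression of $w$ in the $s_i$; such a shortest expression is a reduced word. The (left) descent set of $w$ is $J(w)=\{s_i : \ell(s_iw)<\ell(w)\}=\{s_i: w^{-1}(i+1)<w^{-1}(i)\}$. For $J\subseteq I$, $w_0(J)$ denotes the unique element of maximum length in the subgroup generated by $J$. The Dynkin diagram is the path graph on $I$ with $s_i$ adjacent to $s_{i+1}$. A permutation $w\in S_n$ is \emph{spherical} if it has a reduced word $s_{i_1}\cdots s_{i_{\ell(w)}}$ such that (S.1) for every $s_j\in I\setminus J(w)$, $|\{t: s_{i_t}=s_j\}|\le 1$; and (S.2) for every connected component $C$ of the induced subgraph of the Dynkin diagram on $J(w)$, $|\{t : s_{i_t}\in C\}|\le \ell(w_0(C))+|C|$. Pattern avoidance: writing $w=w_1\dots w_n$ in one-line notation, $w$ contains $p\in S_k$ if there are positions $i_1<\dots<i_k$ with $w_{i_1}\dots w_{i_k}$ in the same relative order as $p_1\dots p_k$; otherwise $w$ avoids $p$. *)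

theory Defs
  imports Main "HOL-Combinatorics.Permutations" "HOL-Algebra.Sym_Groups"
begin

text \<open>
  A permutation in \<open>S\<^sub>n\<close> is a function \<open>w :: nat \<Rightarrow> nat\<close> with \<open>w permutes {1..n}\<close>, i.e. an element
  of the carrier of \<^term>\<open>sym_group n\<close>; multiplication is composition of functions. The simple
  generator \<open>s\<^sub>i\<close> is referred to by its index \<open>i\<close>, so sets of simple generators are sets of indices
  and words in the simple generators are lists of indices.
\<close>

definition simple_indices :: "nat \<Rightarrow> nat set" where
  "simple_indices n = {1..<n}"

definition simple_refl :: "nat \<Rightarrow> nat \<Rightarrow> nat" where
  "simple_refl i = Transposition.transpose i (i + 1)"

definition word_prod :: "nat list \<Rightarrow> nat \<Rightarrow> nat" where
  "word_prod is = foldr (\<lambda>i v. simple_refl i \<circ> v) is id"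

definition coxeter_length :: "nat \<Rightarrow> (nat \<Rightarrow> nat) \<Rightarrow> nat" where
  "coxeter_length n w =
     (LEAST k. \<exists>is. set is \<subseteq> simple_indices n \<and> word_prod is = w \<and> length is = k)"

definition reduced_word :: "nat \<Rightarrow> (nat \<Rightarrow> nat) \<Rightarrow> nat list \<Rightarrow> bool" where
  "reduced_word n w is \<longleftrightarrow>
     set is \<subseteq> simple_indices n \<and> word_prod is = w \<and> length is = coxeter_length n w"

definition descents :: "nat \<Rightarrow> (nat \<Rightarrow> nat) \<Rightarrow> nat set" where
  "descents n w =
     {i \<in> simple_indices n. coxeter_length n (simple_refl i \<circ> w) < coxeter_length n w}"

definition parabolic :: "nat \<Rightarrow> nat set \<Rightarrow> (nat \<Rightarrow> nat) set" where
  "parabolic n J = generate (sym_group n) (simple_refl ` J)"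

definition longest_element :: "nat \<Rightarrow> nat set \<Rightarrow> nat \<Rightarrow> nat" where
  "longest_element n J =
     (THE w. is_arg_max (coxeter_length n) (\<lambda>v. v \<in> parabolic n J) w)"

definition dynkin :: "nat \<Rightarrow> nat rel" where
  "dynkin n = {(i, j). i \<in> simple_indices n \<and> j \<in> simple_indices n \<and> (j = i + 1 \<or> i = j + 1)}"

text \<open>Vertex sets of the connected components of the induced subgraph on \<open>J\<close>.\<close>

definition dynkin_components :: "nat \<Rightarrow> nat set \<Rightarrow> nat set set" where
  "dynkin_components n J = J // (dynkin n \<inter> J \<times> J)\<^sup>*"

definition spherical :: "nat \<Rightarrow> (nat \<Rightarrow> nat) \<Rightarrow> bool" where
  "spherical n w \<longleftrightarrow>
     (\<exists>is. reduced_word n w is \<and>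
        (\<forall>j \<in> simple_indices n - descents n w. card {t. t < length is \<and> is ! t = j} \<le> 1) \<and>
        (\<forall>C \<in> dynkin_components n (descents n w).
           card {t. t < length is \<and> is ! t \<in> C}
             \<le> coxeter_length n (longest_element n C) + card C))"

text \<open>
  Patterns are given in one-line notation as lists. The positions \<open>is\<close> in \<open>w\<close> are counted from 1,
  the entries of the list \<open>p\<close> from 0.
\<close>

definition contains_pattern :: "nat \<Rightarrow> (nat \<Rightarrow> nat) \<Rightarrow> nat list \<Rightarrow> bool" where
  "contains_pattern n w p \<longleftrightarrow>
     (\<exists>is. length is = length p \<and> set is \<subseteq> {1..n} \<and> sorted_wrt (<) is \<and>
        (\<forall>a < length p. \<forall>b < length p. w (is ! a) < w (is ! b) \<longleftrightarrow> p ! a < p ! b))"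

definition avoids :: "nat \<Rightarrow> (nat \<Rightarrow> nat) \<Rightarrow> nat list \<Rightarrow> bool" where
  "avoids n w p \<longleftrightarrow> \<not> contains_pattern n w p"

definition spherical_patterns :: "nat list set" where
  "spherical_patterns =
    {[2,4,5,3,1], [2,5,3,1,4], [2,5,3,4,1], [3,4,5,1,2], [3,4,5,2,1],
     [3,5,4,1,2], [3,5,4,2,1], [4,2,5,3,1], [4,5,1,2,3], [4,5,2,1,3],
     [4,5,2,3,1], [4,5,3,1,2], [5,2,3,1,4], [5,2,3,4,1], [5,3,1,2,4],
     [5,3,1,4,2], [5,3,4,1,2], [5,3,4,2,1], [5,4,1,2,3], [5,4,2,1,3],
     [5,4,2,3,1]}"

end

theory Submission
  imports Defs
begin

text \<open>
  Write \<open>w = v u\<close> with \<open>v\<close> in the parabolic subgroup of \<open>J = J(w)\<close> and \<open>u\<close> without left descents in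
  \<open>J\<close>. In one-line notation \<open>J\<close> cuts the values into blocks of consecutive values; each block appears
  in decreasing order in \<open>w\<close> and in increasing order in \<open>u\<close>. Both sides of the equivalence say that
  \<open>u\<close> avoids 321 and 3412, that is, \<open>u\<close> is a product of distinct simple generators.

  If \<open>u\<close> is such a product, a reduced word of \<open>v\<close> followed by one of \<open>u\<close> satisfies (S.1) and (S.2).
  Conversely, take a reduced word with (S.1) and (S.2). A letter \<open>k \<notin> J\<close> occurs at most once, so at
  most one value moves across the boundary \<open>k\<close> in each direction; this excludes 3412. If
  \<open>x < y < z\<close> formed a 321 with all three values in different blocks, then \<open>x\<close> and \<open>z\<close> would have to
  pass through the block of \<open>y\<close>, which takes more letters than (S.2) allows.

  A 321 or 3412 in \<open>u\<close> is witnessed in \<open>w\<close> by one further value for each pair of neighbouring values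
  that has to lie in different blocks, which leaves the twenty one patterns of length 5.
\<close>

subsection \<open>Words and inversions\<close>

text \<open>\<open>pos w v\<close> is the position of the value \<open>v\<close> in the one-line notation of \<open>w\<close>.\<close>

abbreviation pos :: "(nat \<Rightarrow> nat) \<Rightarrow> nat \<Rightarrow> nat" where
  "pos w \<equiv> inv_into UNIV w"

text \<open>Used with \<open>f = pos w\<close>: the pairs are then pairs of values, the larger one
  standing to the left. \<open>S\<close> need not be an interval, so that inversions among a few
  chosen values can be followed.\<close>

definition inversions :: "nat set \<Rightarrow> (nat \<Rightarrow> nat) \<Rightarrow> (nat \<times> nat) set" where
  "inversions S f = {(a, b). a \<in> S \<and> b \<in> S \<and> a < b \<and> f b < f a}"

lemma finite_inversions: "finite S \<Longrightarrow> finite (inversions S f)"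
  by (rule finite_subset[of _ "S \<times> S"]) (auto simp: inversions_def)

lemma bij_simple_refl: "bij (simple_refl i)"
  by (simp add: simple_refl_def)

lemma simple_refl_involutive [simp]: "simple_refl i (simple_refl i x) = x"
  by (simp add: simple_refl_def)

lemma simple_refl_apply: "simple_refl i x = (if x = i then i + 1 else if x = i + 1 then i else x)"
  by (simp add: simple_refl_def transpose_def)

lemma inv_simple_refl [simp]: "pos (simple_refl i) = simple_refl i"
  by (simp add: simple_refl_def)

lemma word_prod_Nil [simp]: "word_prod [] = id"
  and word_prod_Cons [simp]: "word_prod (i # is) = simple_refl i \<circ> word_prod is"
  by (simp_all add: word_prod_def)

lemma word_prod_append [simp]: "word_prod (xs @ ys) = word_prod xs \<circ> word_prod ys"
  by (induction xs) (auto simp: fun_eq_iff)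

lemma bij_word_prod: "bij (word_prod is)"
proof (induction "is")
  case Nil
  show ?case unfolding word_prod_Nil by (rule bij_id)
next
  case (Cons i "is")
  then show ?case unfolding word_prod_Cons by (intro bij_comp bij_simple_refl)
qed

lemma inv_word_prod: "pos (word_prod is) = word_prod (rev is)"
proof (induction "is")
  case Nil
  show ?case unfolding word_prod_Nil rev.simps by (rule inv_id)
next
  case (Cons i "is")
  have "pos (word_prod (i # is)) = pos (word_prod is) \<circ> simple_refl i"
    unfolding word_prod_Cons by (simp only: o_inv_distrib[OF bij_simple_refl bij_word_prod] inv_simple_refl)
  also have "\<dots> = word_prod (rev (i # is))"
    unfolding Cons by simp
  finally show ?case .
qed

lemma word_prod_rev_cancel [simp]: "word_prod (rev is) (word_prod is x) = x"
  by (metis bij_word_prod bij_is_inj inv_f_f inv_word_prod)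

lemma permutes_simple_refl: "i \<in> {1..<n} \<Longrightarrow> simple_refl i permutes {1..n}"
  unfolding simple_refl_def by (rule permutes_swap_id) auto

lemma permutes_word_prod: "set is \<subseteq> {a..<b} \<Longrightarrow> word_prod is permutes {a..b}"
proof (induction "is")
  case (Cons i "is")
  have "simple_refl i permutes {a..b}"
    unfolding simple_refl_def using Cons.prems by (intro permutes_swap_id) auto
  moreover have "word_prod is permutes {a..b}" using Cons by simp
  ultimately show ?case unfolding word_prod_Cons by (intro permutes_compose)
next
  case Nil
  show ?case unfolding word_prod_Nil by (rule permutes_id)
qed

text \<open>Only the letter \<open>k\<close> exchanges \<open>k\<close> and \<open>k + 1\<close>;
  every other letter preserves the set of numbers up to \<open>k\<close>.\<close>

lemma word_prod_le_iff: "k \<notin> set is \<Longrightarrow> word_prod is v \<le> k \<longleftrightarrow> v \<le> k"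
proof (induction "is" arbitrary: v)
  case (Cons i "is")
  have "simple_refl i u \<le> k \<longleftrightarrow> u \<le> k" for u
    using Cons.prems by (auto simp: simple_refl_apply)
  with Cons show ?case by simp
qed simp

section \<open>The effect of one letter on the number of inversions\<close>

lemma inversions_value_swap:
  assumes "i \<in> S" "i + 1 \<in> S" "finite S" "f i < f (i + 1)"
  shows "card (inversions S (f \<circ> simple_refl i)) = Suc (card (inversions S f))"
proof -
  \<comment> \<open>Precomposition is left multiplication of the permutation: it exchanges the
    values \<open>i\<close> and \<open>i + 1\<close>. Renaming by \<open>?g\<close> matches the
    inversions, since it reverses the order of no pair but \<open>(i, i + 1)\<close>, which becomes
    the one new inversion.\<close>
  let ?g = "map_prod (simple_refl i) (simple_refl i)"
  have eq: "inversions S (f \<circ> simple_refl i) = insert (i, i + 1) (?g ` inversions S f)"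
  proof (intro equalityI subrelI)
    fix a b assume *: "(a, b) \<in> inversions S (f \<circ> simple_refl i)"
    show "(a, b) \<in> insert (i, i + 1) (?g ` inversions S f)"
    proof (rule ccontr)
      assume **: "\<not> ?thesis"
      have "?g (simple_refl i a, simple_refl i b) = (a, b)" by simp
      with ** have "(simple_refl i a, simple_refl i b) \<notin> inversions S f"
        by (metis imageI insertI2)
      with * ** assms(1,2,4) show False
        by (auto simp: inversions_def simple_refl_apply split: if_splits)
    qed
  next
    fix a b assume "(a, b) \<in> insert (i, i + 1) (?g ` inversions S f)"
    then show "(a, b) \<in> inversions S (f \<circ> simple_refl i)"
      using assms(1,2,4)
      by (auto simp: inversions_def simple_refl_apply split: if_splits)
  qed
  have "(i, i + 1) \<notin> ?g ` inversions S f"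
  proof
    assume "(i, i + 1) \<in> ?g ` inversions S f"
    then obtain a b where "i = simple_refl i a" "i + 1 = simple_refl i b" "a < b"
      by (auto simp: inversions_def)
    then have "a = simple_refl i i" "b = simple_refl i (i + 1)" "a < b"
      by (metis simple_refl_involutive)+
    then show False by (simp add: simple_refl_apply)
  qed
  moreover have "inj_on ?g (inversions S f)"
    by (intro inj_on_subset[OF prod.inj_map]) (auto intro: bij_is_inj bij_simple_refl)
  ultimately show ?thesis
    unfolding eq using finite_inversions[OF assms(3)] by (simp add: card_image)
qed

lemma inversions_value_swap_outside:
  assumes "i \<notin> S" "i + 1 \<notin> S"
  shows "inversions S (f \<circ> simple_refl i) = inversions S f"
  using assms by (auto simp: inversions_def simple_refl_apply split: if_splits)

text \<open>Postcomposition is right multiplication: it exchanges the values \<open>a\<close> and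
  \<open>b\<close> at the adjacent positions \<open>j\<close> and \<open>j + 1\<close>, so no other
  pair changes its relative order.\<close>

lemma inversions_position_swap_iff:
  assumes "bij f" "f a = j" "f b = j + 1" "(x, y) \<noteq> (a, b)" "(x, y) \<noteq> (b, a)"
  shows "(x, y) \<in> inversions S (simple_refl j \<circ> f) \<longleftrightarrow> (x, y) \<in> inversions S f"
proof -
  have iff: "f u = f v \<longleftrightarrow> u = v" for u v
    using assms(1) by (meson bij_is_inj inj_eq)
  have "simple_refl j u < simple_refl j v \<longleftrightarrow> u < v"
    if "\<not> (u = j \<and> v = j + 1)" "\<not> (u = j + 1 \<and> v = j)" for u v
    using that by (auto simp: simple_refl_apply)
  moreover have "\<not> (f y = j \<and> f x = j + 1)" "\<not> (f y = j + 1 \<and> f x = j)"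
    using assms(4,5) iff unfolding assms(2)[symmetric] by (metis assms(2,3))+
  ultimately have "simple_refl j (f y) < simple_refl j (f x) \<longleftrightarrow> f y < f x"
    by blast
  then show ?thesis by (simp add: inversions_def)
qed

lemma inversions_position_swap:
  assumes "bij f" "a \<in> S" "b \<in> S" "finite S" "f a = j" "f b = j + 1" "a < b"
  shows "card (inversions S (simple_refl j \<circ> f)) = Suc (card (inversions S f))"
proof -
  have "inversions S (simple_refl j \<circ> f) = insert (a, b) (inversions S f)"
  proof (rule Set.set_eqI)
    fix xy :: "nat \<times> nat"
    obtain x y where xy: "xy = (x, y)" by (cases xy)
    have "(a, b) \<in> inversions S (simple_refl j \<circ> f)"
      "(b, a) \<notin> inversions S (simple_refl j \<circ> f)" "(b, a) \<notin> inversions S f"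
      using assms by (auto simp: inversions_def simple_refl_apply)
    then show "xy \<in> inversions S (simple_refl j \<circ> f) \<longleftrightarrow> xy \<in> insert (a, b) (inversions S f)"
      using inversions_position_swap_iff[OF assms(1,5,6), of x y S] assms(7) xy by auto
  qed
  moreover have "(a, b) \<notin> inversions S f" using assms by (auto simp: inversions_def)
  ultimately show ?thesis using finite_inversions[OF assms(4)] by simp
qed

text \<open>The order of \<open>a\<close> and \<open>b\<close> is left open: if
  \<open>b < a\<close>, the exchange removes an inversion, hence only an inequality.\<close>

lemma inversions_position_swap_le:
  assumes "bij f" "finite S" "f a = j" "f b = j + 1"
  shows "card (inversions S (simple_refl j \<circ> f))
           \<le> card (inversions S f) + (if a \<in> S \<and> b \<in> S then 1 else 0)"
proof -
  let ?N = "if a \<in> S \<and> b \<in> S then {(a, b)} else {}"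
  have "inversions S (simple_refl j \<circ> f) \<subseteq> inversions S f \<union> ?N"
  proof (intro subrelI)
    fix x y assume xy: "(x, y) \<in> inversions S (simple_refl j \<circ> f)"
    have "(b, a) \<notin> inversions S (simple_refl j \<circ> f)"
      using assms by (auto simp: inversions_def simple_refl_apply)
    then show "(x, y) \<in> inversions S f \<union> ?N"
      using xy inversions_position_swap_iff[OF assms(1,3,4), of x y S]
      by (cases "(x, y) = (a, b)"; cases "(x, y) = (b, a)") (auto simp: inversions_def)
  qed
  then have "card (inversions S (simple_refl j \<circ> f)) \<le> card (inversions S f \<union> ?N)"
    using finite_inversions[OF assms(2)] by (intro card_mono) auto
  also have "\<dots> \<le> card (inversions S f) + card ?N" by (rule card_Un_le)
  finally show ?thesis by (auto split: if_splits)
qed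

text \<open>Read from the left, the letter \<open>j\<close> after the prefix \<open>pre\<close>
  exchanges the values \<open>word_prod pre j\<close> and \<open>word_prod pre (j + 1)\<close>. It
  creates at most one inversion, and one inside \<open>S\<close> only if both values lie in
  \<open>S\<close>, which forces \<open>j\<close> into \<open>L\<close>.\<close>

lemma inversions_word_le:
  assumes "finite S"
    and "\<And>pre j suf. is = pre @ j # suf \<Longrightarrow> j \<in> L \<or> word_prod pre j \<notin> S \<or> word_prod pre (j + 1) \<notin> S"
  shows "card (inversions S (pos (word_prod is))) \<le> length (filter (\<lambda>j. j \<in> L) is)"
  using assms(2)
proof (induction "is" rule: rev_induct)
  case Nil
  have "inversions S id = {}" by (auto simp: inversions_def)
  then have "card (inversions S (pos (word_prod []))) \<le> length (filter (\<lambda>j. j \<in> L) [])"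
    by (simp only: word_prod_Nil inv_id card.empty le0)
  then show ?case .
next
  case (snoc j "is")
  let ?f = "pos (word_prod is)"
  have IH: "card (inversions S ?f) \<le> length (filter (\<lambda>j. j \<in> L) is)"
    by (rule snoc.IH) (use snoc.prems in auto)
  have "pos (word_prod (is @ [j])) = simple_refl j \<circ> ?f"
    by (simp add: o_inv_distrib bij_word_prod bij_simple_refl)
  moreover have "card (inversions S (simple_refl j \<circ> ?f)) \<le> card (inversions S ?f)
     + (if word_prod is j \<in> S \<and> word_prod is (j + 1) \<in> S then 1 else 0)"
    by (rule inversions_position_swap_le)
      (use assms(1) in \<open>auto simp: bij_word_prod bij_imp_bij_inv bij_is_inj inv_f_f\<close>)
  moreover have "j \<in> L \<or> word_prod is j \<notin> S \<or> word_prod is (j + 1) \<notin> S"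
    by (rule snoc.prems) simp
  ultimately have "card (inversions S (pos (word_prod (is @ [j]))))
      \<le> length (filter (\<lambda>j. j \<in> L) is) + (if j \<in> L then 1 else 0)"
    using IH by (simp only: split: if_splits) auto
  also have "\<dots> = length (filter (\<lambda>j. j \<in> L) (is @ [j]))" by simp
  finally show ?case .
qed


section \<open>Coset factorization, and the Coxeter length as number of inversions\<close>

lemma permutes_increasing_imp_id:
  fixes u :: "nat \<Rightarrow> nat"
  assumes u: "u permutes {a..b}" and incr: "\<And>i. i \<in> {a..<b} \<Longrightarrow> u i < u (i + 1)"
  shows "u = id"
proof -
  have mem: "u i \<in> {a..b} \<longleftrightarrow> i \<in> {a..b}" for i
    using u by (rule permutes_in_image)
  have lower: "i \<le> u i" if "a \<le> i" "i \<le> b" for i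
    using that
  proof (induction i rule: dec_induct)
    case base
    then show ?case using mem[of a] by simp
  next
    case (step i)
    then show ?case using incr[of i] by simp
  qed
  have upper: "u i \<le> i" if "i \<le> b" "a \<le> i" for i
    using that
  proof (induction i rule: inc_induct)
    case base
    then show ?case using mem[of b] by simp
  next
    case (step i)
    then show ?case using incr[of i] by simp
  qed
  show ?thesis
  proof
    fix i
    show "u i = id i"
    proof (cases "i \<in> {a..b}")
      case True
      then show ?thesis using lower[of i] upper[of i] by simp
    next
      case False
      then show ?thesis using permutes_not_in[OF u] by simp
    qed
  qed
qed

lemma pos_simple_refl_comp: "bij w \<Longrightarrow> pos (simple_refl i \<circ> w) = pos w \<circ> simple_refl i"
  by (simp add: o_inv_distrib[OF bij_simple_refl])

lemma simple_refl_comp_involutive: "simple_refl i \<circ> (simple_refl i \<circ> w) = w"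
  "w \<circ> simple_refl i \<circ> simple_refl i = w"
  by (simp_all add: fun_eq_iff)

text \<open>
  Removing left descents in \<open>J\<close> one at a time leads to the minimal representative \<open>u\<close> of the coset of
  \<open>w\<close>. Each removed letter lowers by one the number of inversions inside its own block \<open>{a..b}\<close> and
  does not change the number inside another one.
\<close>

lemma parabolic_factorization:
  assumes "J \<subseteq> {1..<n}" "w permutes {1..n}"
  shows "\<exists>is u. set is \<subseteq> J \<and> w = word_prod is \<circ> u \<and> u permutes {1..n} \<and>
    (\<forall>i \<in> J. pos u i < pos u (i + 1)) \<and>
    (\<forall>a b. 1 \<le> a \<longrightarrow> a - 1 \<notin> J \<longrightarrow> b \<notin> J \<longrightarrow>
       length (filter (\<lambda>i. i \<in> {a..<b}) is) + card (inversions {a..b} (pos u))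
         = card (inversions {a..b} (pos w)))"
  using assms(2)
proof (induction "card (inversions {1..n} (pos w))" arbitrary: w rule: less_induct)
  case less
  have bij: "bij (pos w)"
    using less.prems by (intro bij_imp_bij_inv permutes_bij)
  show ?case
  proof (cases "\<exists>i \<in> J. pos w (i + 1) < pos w i")
    case False
    have "pos w i < pos w (i + 1)" if "i \<in> J" for i
    proof -
      have "pos w i \<noteq> pos w (i + 1)" using bij by (metis bij_is_inj inj_eq n_not_Suc_n Suc_eq_plus1)
      then show ?thesis using False that by (meson linorder_neqE_nat)
    qed
    then show ?thesis
      by (intro exI[of _ "[]"] exI[of _ w]) (use less.prems in auto)
  next
    case True
    then obtain i where i: "i \<in> J" "pos w (i + 1) < pos w i" by blast
    define v where "v = simple_refl i \<circ> w"
    have v: "v permutes {1..n}"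
      unfolding v_def using less.prems i(1) assms(1)
      by (intro permutes_compose permutes_simple_refl) auto
    have posv: "pos v = pos w \<circ> simple_refl i"
      unfolding v_def using less.prems by (intro pos_simple_refl_comp permutes_bij)
    have posw: "pos w = pos v \<circ> simple_refl i"
      by (simp only: posv simple_refl_comp_involutive)
    have asc: "pos v i < pos v (i + 1)"
      using i(2) by (simp add: posv simple_refl_apply)
    have count: "card (inversions {a..b} (pos w))
        = card (inversions {a..b} (pos v)) + (if i \<in> {a..<b} then 1 else 0)"
      if "1 \<le> a" "a - 1 \<notin> J" "b \<notin> J" for a b
    proof (cases "i \<in> {a..<b}")
      case True
      then show ?thesis
        unfolding posw using inversions_value_swap[of i "{a..b}" "pos v"] asc by simp
    next
      case False
      \<comment> \<open>Blocks end at boundaries outside \<open>J\<close>, so a letter of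
        \<open>J\<close> outside \<open>{a..<b}\<close> moves no value of
        \<open>{a..b}\<close>.\<close>
      have "i \<noteq> a - 1" "i \<noteq> b" using that i(1) by auto
      then have "i \<notin> {a..b}" "i + 1 \<notin> {a..b}" using False by auto
      then have "inversions {a..b} (pos w) = inversions {a..b} (pos v)"
        unfolding posw by (intro inversions_value_swap_outside) blast+
      then show ?thesis using False by simp
    qed
    \<comment> \<open>The boundaries \<open>0\<close> and \<open>n\<close> of the whole range are
      outside \<open>J\<close> too; the count for \<open>{1..n}\<close> gives the decrease for the
      induction.\<close>
    have "i \<in> {1..<n}" "0 \<notin> J" "n \<notin> J" using i(1) assms(1) by auto
    then have "card (inversions {1..n} (pos v)) < card (inversions {1..n} (pos w))"
      using count[of 1 n] by simp
    from less.hyps[OF this v] obtain "is" u where u: "set is \<subseteq> J" "v = word_prod is \<circ> u"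
      "u permutes {1..n}" "\<forall>i \<in> J. pos u i < pos u (i + 1)"
      and counts: "\<forall>a b. 1 \<le> a \<longrightarrow> a - 1 \<notin> J \<longrightarrow> b \<notin> J \<longrightarrow>
       length (filter (\<lambda>i. i \<in> {a..<b}) is) + card (inversions {a..b} (pos u))
         = card (inversions {a..b} (pos v))"
      by blast
    have "w = simple_refl i \<circ> v"
      unfolding v_def by (simp only: simple_refl_comp_involutive)
    then have "w = word_prod (i # is) \<circ> u"
      unfolding u(2) by (simp only: word_prod_Cons comp_assoc)
    moreover have "length (filter (\<lambda>i. i \<in> {a..<b}) (i # is)) + card (inversions {a..b} (pos u))
         = card (inversions {a..b} (pos w))" if "1 \<le> a" "a - 1 \<notin> J" "b \<notin> J" for a b
      using counts count[OF that] that by auto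
    ultimately show ?thesis
      using u i(1) by (intro exI[of _ "i # is"] exI[of _ u]) auto
  qed
qed

lemma card_inversions_le_length:
  assumes "finite S"
  shows "card (inversions S (pos (word_prod is))) \<le> length is"
  using inversions_word_le[OF assms, of "is" UNIV] by simp

text \<open>Factor along all of \<open>{a..<b}\<close>: the remaining coset representative permutes
  \<open>{a..b}\<close> without descents, so it is the identity and the word alone gives
  \<open>w\<close>.\<close>

lemma obtain_word:
  assumes "w permutes {a..b}" "1 \<le> a"
  obtains "is" where "set is \<subseteq> {a..<b}" "w = word_prod is"
    "length is = card (inversions {a..b} (pos w))"
proof -
  have "w permutes {1..b}"
    using assms by (auto intro: permutes_subset)
  moreover have "{a..<b} \<subseteq> {1..<b}" using assms(2) by auto
  ultimately obtain "is" u where u: "set is \<subseteq> {a..<b}" "w = word_prod is \<circ> u"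
      "\<forall>i \<in> {a..<b}. pos u i < pos u (i + 1)"
    and counts: "\<forall>c d. 1 \<le> c \<longrightarrow> c - 1 \<notin> {a..<b} \<longrightarrow> d \<notin> {a..<b} \<longrightarrow>
       length (filter (\<lambda>i. i \<in> {c..<d}) is) + card (inversions {c..d} (pos u))
         = card (inversions {c..d} (pos w))"
    using parabolic_factorization[of "{a..<b}" b w] by blast
  have "u = word_prod (rev is) \<circ> w"
    unfolding u(2) by (simp add: fun_eq_iff)
  moreover have "word_prod (rev is) permutes {a..b}"
    using u(1) by (intro permutes_word_prod) simp
  ultimately have "u permutes {a..b}"
    using assms(1) by (simp only: permutes_compose)
  then have "pos u = id"
    using u(3) by (intro permutes_increasing_imp_id[of _ a b] permutes_inv) auto
  moreover from this have "u = id"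
    using \<open>u permutes {a..b}\<close> by (metis permutes_inv_inv inv_id)
  moreover have "inversions {a..b} id = {}" by (auto simp: inversions_def)
  ultimately have "length (filter (\<lambda>i. i \<in> {a..<b}) is) = card (inversions {a..b} (pos w))"
    using counts[rule_format, of a b] assms(2) by (cases a) auto
  moreover have "filter (\<lambda>i. i \<in> {a..<b}) is = is"
    using u(1) by (intro filter_True) auto
  ultimately show thesis
    using that[of "is"] u \<open>u = id\<close> by simp
qed

text \<open>No letter creates more than one inversion, which bounds the length from below;
  \<open>obtain_word\<close> attains the bound.\<close>

lemma coxeter_length_eq:
  assumes "w permutes {1..n}"
  shows "coxeter_length n w = card (inversions {1..n} (pos w))"
  unfolding coxeter_length_def
proof (rule Least_equality)
  show "\<exists>is. set is \<subseteq> simple_indices n \<and> word_prod is = w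
      \<and> length is = card (inversions {1..n} (pos w))"
    using obtain_word[OF assms] by (metis order_refl simple_indices_def)
qed (auto intro: card_inversions_le_length)

lemma mem_descents_iff:
  assumes "w permutes {1..n}"
  shows "i \<in> descents n w \<longleftrightarrow> i \<in> {1..<n} \<and> pos w (i + 1) < pos w i"
proof (cases "i \<in> {1..<n}")
  case True
  have S: "i \<in> {1..n}" "i + 1 \<in> {1..n}" using True by auto
  have inj: "inj (pos w)"
    using assms by (intro bij_is_inj permutes_bij permutes_inv)
  have perm: "simple_refl i \<circ> w permutes {1..n}"
    using assms True by (intro permutes_compose permutes_simple_refl)
  have pos: "pos (simple_refl i \<circ> w) = pos w \<circ> simple_refl i"
    using assms by (intro pos_simple_refl_comp permutes_bij)
  have "pos w i \<noteq> pos w (i + 1)"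
    using inj by (metis inj_eq n_not_Suc_n Suc_eq_plus1)
  then consider "pos w i < pos w (i + 1)" | "pos w (i + 1) < pos w i" by linarith
  then show ?thesis
  proof cases
    case 1
    then show ?thesis
      using inversions_value_swap[OF S, of "pos w"] coxeter_length_eq[OF perm] coxeter_length_eq[OF assms]
      by (simp add: descents_def simple_indices_def pos)
  next
    case 2
    then have "card (inversions {1..n} (pos w)) = Suc (card (inversions {1..n} (pos w \<circ> simple_refl i)))"
      using inversions_value_swap[OF S, of "pos w \<circ> simple_refl i"]
      by (simp add: simple_refl_comp_involutive simple_refl_apply)
    then show ?thesis
      using 2 True coxeter_length_eq[OF perm] coxeter_length_eq[OF assms]
      by (simp add: descents_def simple_indices_def pos)
  qed
qed (auto simp: descents_def simple_indices_def)


subsection \<open>Longest elements and components of the Dynkin diagram\<close>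

text \<open>Values outside \<open>{a..b}\<close> are fixed and those inside stay inside, so no
  inversion involves a value outside.\<close>

lemma inversions_permutes_subinterval:
  assumes "v permutes {a..b}" "1 \<le> a" "b \<le> n"
  shows "inversions {1..n} (pos v) = inversions {a..b} (pos v)"
proof (intro equalityI subrelI)
  have p: "pos v permutes {a..b}" using assms(1) by (rule permutes_inv)
  have fixed: "pos v u = u" if "u \<notin> {a..b}" for u
    using permutes_not_in[OF p that] .
  have mem: "pos v u \<in> {a..b} \<longleftrightarrow> u \<in> {a..b}" for u
    using p by (rule permutes_in_image)
  fix x y assume xy: "(x, y) \<in> inversions {1..n} (pos v)"
  then have "x < y" "pos v y < pos v x" by (auto simp: inversions_def)
  then have "x \<in> {a..b} \<and> y \<in> {a..b}"
    using fixed[of x] fixed[of y] mem[of x] mem[of y]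
    by (cases "x \<in> {a..b}"; cases "y \<in> {a..b}") auto
  then show "(x, y) \<in> inversions {a..b} (pos v)"
    using xy by (auto simp: inversions_def)
next
  fix x y assume "(x, y) \<in> inversions {a..b} (pos v)"
  then show "(x, y) \<in> inversions {1..n} (pos v)"
    using assms(2,3) by (auto simp: inversions_def)
qed

lemma parabolic_interval:
  assumes "1 \<le> a" "b \<le> n"
  shows "parabolic n {a..<b} = {v. v permutes {a..b}}"
proof (intro equalityI subsetI CollectI)
  have gen: "simple_refl i permutes {a..b}" if "i \<in> {a..<b}" for i
    unfolding simple_refl_def using that by (intro permutes_swap_id) auto
  fix v assume "v \<in> parabolic n {a..<b}"
  then show "v permutes {a..b}"
    unfolding parabolic_def
  proof (induction v rule: generate.induct)
    case one
    show ?case unfolding sym_group_one by (rule permutes_id)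
  next
    case (incl h)
    then show ?case using gen by blast
  next
    case (inv h)
    then obtain i where i: "i \<in> {a..<b}" "h = simple_refl i" by blast
    then have "h \<in> carrier (sym_group n)"
      unfolding sym_group_carrier i(2) using assms by (intro permutes_simple_refl) simp
    then show ?case using i gen by (simp add: sym_group_inv_equality)
  next
    case (eng g h)
    show ?case unfolding sym_group_mult using eng.IH(2,1) by (rule permutes_compose)
  qed
next
  fix v assume "v \<in> {v. v permutes {a..b}}"
  then obtain "is" where "set is \<subseteq> {a..<b}" "v = word_prod is"
    using obtain_word assms(1) by (metis mem_Collect_eq)
  moreover have "word_prod is \<in> generate (sym_group n) (simple_refl ` {a..<b})"
    if "set is \<subseteq> {a..<b}" for "is"
    using that
  proof (induction "is")
    case Nil
    have "id = \<one>\<^bsub>sym_group n\<^esub>" by (simp add: sym_group_def)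
    then show ?case unfolding word_prod_Nil by (metis generate.one)
  next
    case (Cons i "is")
    have "word_prod (i # is) = simple_refl i \<otimes>\<^bsub>sym_group n\<^esub> word_prod is"
      by (simp add: sym_group_def)
    moreover have "simple_refl i \<in> generate (sym_group n) (simple_refl ` {a..<b})"
      using Cons.prems by (intro generate.incl) auto
    moreover have "word_prod is \<in> generate (sym_group n) (simple_refl ` {a..<b})"
      using Cons by simp
    ultimately show ?case by (metis generate.eng)
  qed
  ultimately show "v \<in> parabolic n {a..<b}"
    unfolding parabolic_def by blast
qed

lemma coxeter_length_longest_element:
  assumes "1 \<le> a" "b \<le> n"
  shows "coxeter_length n (longest_element n {a..<b})
    = card {(x, y). x \<in> {a..b} \<and> y \<in> {a..b} \<and> x < y}"
proof -
  let ?P = "{(x, y). x \<in> {a..b} \<and> y \<in> {a..b} \<and> x < y}"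
  have fin: "finite ?P" by (rule finite_subset[of _ "{a..b} \<times> {a..b}"]) auto
  have sub: "inversions {a..b} f \<subseteq> ?P" for f by (auto simp: inversions_def)
  have len: "coxeter_length n v = card (inversions {a..b} (pos v))" if "v permutes {a..b}" for v
  proof -
    have "v permutes {1..n}" using that assms by (auto intro: permutes_subset)
    then show ?thesis
      using inversions_permutes_subinterval[OF that assms] by (simp add: coxeter_length_eq)
  qed
  \<comment> \<open>The reversal of \<open>{a..b}\<close> is the only permutation of it that inverts
    every pair; this uniqueness is what \<open>THE\<close> in \<open>longest_element\<close> asks
    for.\<close>
  define r where "r x = (if x \<in> {a..b} then a + b - x else x)" for x
  have r_invol: "r (r x) = x" for x by (auto simp: r_def)
  have "bij_betw r {a..b} {a..b}"
    by (rule bij_betw_byWitness[where f' = r]) (auto simp: r_invol, auto simp: r_def)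
  then have r: "r permutes {a..b}" by (rule bij_imp_permutes) (auto simp: r_def)
  have posr: "pos r = r" by (rule inv_unique_comp) (simp_all add: fun_eq_iff r_invol)
  have "inversions {a..b} (pos r) = ?P" by (auto simp: posr inversions_def r_def)
  then have len_r: "coxeter_length n r = card ?P" using len[OF r] by simp
  have le: "coxeter_length n v \<le> card ?P" if "v permutes {a..b}" for v
    using len[OF that] sub fin by (simp add: card_mono)
  have unique: "v = r" if v: "v permutes {a..b}" and "coxeter_length n v = card ?P" for v
  proof -
    have "inversions {a..b} (pos v) = ?P"
      using that(2) len[OF v] by (intro card_subset_eq[OF fin sub]) simp
    then have anti: "pos v y < pos v x" if "x \<in> {a..b}" "y \<in> {a..b}" "x < y" for x y
      using that by (auto simp: inversions_def)
    have pv: "pos v permutes {a..b}" using v by (rule permutes_inv)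
    \<comment> \<open>Both \<open>r\<close> and \<open>pos v\<close> reverse the order on
      \<open>{a..b}\<close>, so their composition is increasing.\<close>
    have "pos v \<circ> r = id"
    proof (rule permutes_increasing_imp_id)
      show "pos v \<circ> r permutes {a..b}" using r pv by (rule permutes_compose)
      fix i assume "i \<in> {a..<b}"
      then show "(pos v \<circ> r) i < (pos v \<circ> r) (i + 1)"
        using anti[of "r (i + 1)" "r i"] by (auto simp: r_def)
    qed
    then have "v \<circ> (pos v \<circ> r) = v" by simp
    moreover have "v \<circ> pos v = id" using v by (rule permutes_inv_o)
    ultimately show "v = r" by (metis comp_assoc id_comp)
  qed
  have "longest_element n {a..<b} = r"
    unfolding longest_element_def
  proof (rule the_equality)
    show "is_arg_max (coxeter_length n) (\<lambda>v. v \<in> parabolic n {a..<b}) r"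
      using le len_r r by (auto simp: is_arg_max_def parabolic_interval[OF assms] not_less)
  next
    fix v assume "is_arg_max (coxeter_length n) (\<lambda>v. v \<in> parabolic n {a..<b}) v"
    then have "v permutes {a..b}" "\<not> coxeter_length n v < coxeter_length n r"
      using r by (auto simp: is_arg_max_def parabolic_interval[OF assms])
    then show "v = r" using unique[of v] le[of v] len_r by simp
  qed
  then show ?thesis using len_r by simp
qed

lemma dynkin_class_eq:
  assumes "J \<subseteq> {1..<n}" "{a..<b} \<subseteq> J" "x \<in> {a..<b}" "1 \<le> a" "a - 1 \<notin> J" "b \<notin> J"
  shows "(dynkin n \<inter> J \<times> J)\<^sup>* `` {x} = {a..<b}"
proof (intro equalityI subsetI)
  let ?R = "dynkin n \<inter> J \<times> J"
  fix y assume "y \<in> ?R\<^sup>* `` {x}"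
  then have "(x, y) \<in> ?R\<^sup>*" by simp
  then show "y \<in> {a..<b}"
  proof (induction rule: rtrancl_induct)
    case base
    then show ?case using assms(3) .
  next
    case (step y z)
    then have "z \<in> J" "z = y + 1 \<or> y = z + 1" by (auto simp: dynkin_def)
    \<comment> \<open>A step out of the interval would reach \<open>a - 1\<close> or
      \<open>b\<close>; as \<open>1 \<le> a\<close>, the subtraction is not truncated.\<close>
    then have "z \<noteq> a - 1" "z \<noteq> b" "z = y + 1 \<or> y = z + 1" using assms(5,6) by auto
    then show ?case using step.IH assms(4) by auto
  qed
next
  let ?R = "dynkin n \<inter> J \<times> J"
  have edge: "(i, i + 1) \<in> ?R" "(i + 1, i) \<in> ?R" if "a \<le> i" "i + 1 < b" for i
  proof -
    have "i \<in> J" "i + 1 \<in> J" using that assms(2) by auto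
    then show "(i, i + 1) \<in> ?R" "(i + 1, i) \<in> ?R"
      using assms(1) by (auto simp: dynkin_def simple_indices_def)
  qed
  fix y assume y: "y \<in> {a..<b}"
  have "(x, y) \<in> ?R\<^sup>*"
  proof (cases "x \<le> y")
    case True
    have "(x, z) \<in> ?R\<^sup>*" if "x \<le> z" "z < b" for z
      using that
    proof (induction z rule: dec_induct)
      case (step z)
      then show ?case using edge(1)[of z] assms(3) by (auto intro: rtrancl_into_rtrancl)
    qed simp
    then show ?thesis using True y by simp
  next
    case False
    have "(x, z) \<in> ?R\<^sup>*" if "z \<le> x" "a \<le> z" for z
      using that
    proof (induction z rule: inc_induct)
      case (step z)
      then show ?case using edge(2)[of z] assms(3) by (auto intro: rtrancl_into_rtrancl)
    qed simp
    then show ?thesis using False y by simp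
  qed
  then show "y \<in> ?R\<^sup>* `` {x}" by simp
qed

lemma mem_dynkin_components_iff:
  assumes J: "J \<subseteq> {1..<n}"
  shows "C \<in> dynkin_components n J \<longleftrightarrow>
    (\<exists>a b. 1 \<le> a \<and> a < b \<and> b \<le> n \<and> C = {a..<b} \<and> {a..<b} \<subseteq> J \<and> a - 1 \<notin> J \<and> b \<notin> J)"
proof
  assume "C \<in> dynkin_components n J"
  then obtain x where x: "x \<in> J" "C = (dynkin n \<inter> J \<times> J)\<^sup>* `` {x}"
    unfolding dynkin_components_def by (elim quotientE)
  have x1: "1 \<le> x" "x < n" using x(1) J by auto
  \<comment> \<open>\<open>c\<close> and \<open>b\<close> are the indices outside \<open>J\<close>
    nearest to \<open>x\<close> below and above; they exist because \<open>0\<close> and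
    \<open>n\<close> are not in \<open>J\<close>.\<close>
  define c where "c = (GREATEST k. k < x \<and> k \<notin> J)"
  define b where "b = (LEAST k. x < k \<and> k \<notin> J)"
  have "0 < x \<and> 0 \<notin> J" using x1 J by auto
  then have c: "c < x \<and> c \<notin> J"
    unfolding c_def by (rule GreatestI_nat[where b = x]) auto
  have c_max: "k \<le> c" if "k < x" "k \<notin> J" for k
    unfolding c_def using that by (intro Greatest_le_nat[where b = x]) auto
  have n: "x < n \<and> n \<notin> J" using x1 J by auto
  then have b: "x < b \<and> b \<notin> J"
    unfolding b_def by (rule LeastI)
  have b_min: "b \<le> k" if "x < k" "k \<notin> J" for k
    unfolding b_def using that by (intro Least_le) auto
  have sub: "{c + 1..<b} \<subseteq> J"
  proof
    fix k assume "k \<in> {c + 1..<b}"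
    then show "k \<in> J" using c_max[of k] b_min[of k] x(1) by (cases k x rule: linorder_cases) auto
  qed
  have "C = {c + 1..<b}"
    unfolding x(2) using b c by (intro dynkin_class_eq J sub) auto
  then show "\<exists>a b. 1 \<le> a \<and> a < b \<and> b \<le> n \<and> C = {a..<b} \<and> {a..<b} \<subseteq> J \<and> a - 1 \<notin> J \<and> b \<notin> J"
    using b c sub n b_min[of n] by (intro exI[of _ "c + 1"] exI[of _ b]) auto
next
  assume "\<exists>a b. 1 \<le> a \<and> a < b \<and> b \<le> n \<and> C = {a..<b} \<and> {a..<b} \<subseteq> J \<and> a - 1 \<notin> J \<and> b \<notin> J"
  then obtain a b where ab: "1 \<le> a" "a < b" "C = {a..<b}" "{a..<b} \<subseteq> J" "a - 1 \<notin> J" "b \<notin> J"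
    by blast
  then have "C = (dynkin n \<inter> J \<times> J)\<^sup>* `` {a}"
    using dynkin_class_eq[OF J ab(4), of a] by simp
  then show "C \<in> dynkin_components n J"
    unfolding dynkin_components_def using ab by (auto intro: quotientI)
qed

subsection \<open>Boundaries crossed by a word\<close>

text \<open>
  Here \<open>f\<close> sends a value to its position. These two conditions say that \<open>w\<^sub>0(J) w\<close> contains 321,
  respectively 3412: a value \<open>k\<close> with \<open>f k < f (k + 1)\<close> is a boundary between two of the blocks that
  are reversed by \<open>w\<^sub>0(J)\<close>.
\<close>

definition crossing_321 :: "nat \<Rightarrow> (nat \<Rightarrow> nat) \<Rightarrow> bool" where
  "crossing_321 n f \<longleftrightarrow> (\<exists>x y z k l. 1 \<le> x \<and> x \<le> k \<and> k < y \<and> y \<le> l \<and> l < z \<and> z \<le> n \<and>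
     f z < f y \<and> f y < f x \<and> f k < f (k + 1) \<and> f l < f (l + 1))"

definition crossing_3412 :: "nat \<Rightarrow> (nat \<Rightarrow> nat) \<Rightarrow> bool" where
  "crossing_3412 n f \<longleftrightarrow> (\<exists>a b c d k. 1 \<le> a \<and> a < b \<and> b \<le> k \<and> k < c \<and> c < d \<and> d \<le> n \<and>
     max (f c) (f d) < min (f a) (f b) \<and> f k < f (k + 1))"

text \<open>If \<open>k\<close> occurs, split the word as \<open>xs @ k # ys\<close>. Neither
  \<open>xs\<close> nor \<open>ys\<close> moves a value across the boundary, so a value crosses
  upwards only from position \<open>k\<close> after \<open>xs\<close>, and downwards only from
  \<open>k + 1\<close>.\<close>

lemma word_prod_crossing_unique:
  assumes "length (filter (\<lambda>j. j = k) is) \<le> 1"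
  defines "f \<equiv> pos (word_prod is)"
  shows "u \<le> k \<Longrightarrow> v \<le> k \<Longrightarrow> k < f u \<Longrightarrow> k < f v \<Longrightarrow> u = v"
    and "k < u \<Longrightarrow> k < v \<Longrightarrow> f u \<le> k \<Longrightarrow> f v \<le> k \<Longrightarrow> u = v"
proof -
  have f: "f = word_prod (rev is)" unfolding f_def by (rule inv_word_prod)
  have "(\<forall>u v. u \<le> k \<and> v \<le> k \<and> k < f u \<and> k < f v \<longrightarrow> u = v)
      \<and> (\<forall>u v. k < u \<and> k < v \<and> f u \<le> k \<and> f v \<le> k \<longrightarrow> u = v)"
  proof (cases "k \<in> set is")
    case False
    then have "f v \<le> k \<longleftrightarrow> v \<le> k" for v
      using word_prod_le_iff[of k "rev is"] f by simp
    then show ?thesis by (metis not_le)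
  next
    case True
    then obtain xs ys where xs: "is = xs @ k # ys" by (meson split_list)
    then have nin: "k \<notin> set (rev xs)" "k \<notin> set (rev ys)"
      using assms(1) by (auto simp: filter_empty_conv)
    have fv: "f v = word_prod (rev ys) (simple_refl k (word_prod (rev xs) v))" for v
      unfolding f xs by simp
    have le: "f v \<le> k \<longleftrightarrow> simple_refl k (word_prod (rev xs) v) \<le> k" for v
      unfolding fv by (rule word_prod_le_iff[OF nin(2)])
    have le': "word_prod (rev xs) v \<le> k \<longleftrightarrow> v \<le> k" for v
      by (rule word_prod_le_iff[OF nin(1)])
    have "word_prod (rev xs) v = k" if "v \<le> k" "\<not> f v \<le> k" for v
      using that le[of v] le'[of v] by (auto simp: simple_refl_apply split: if_splits)
    moreover have "word_prod (rev xs) v = k + 1" if "\<not> v \<le> k" "f v \<le> k" for v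
      using that le[of v] le'[of v] by (auto simp: simple_refl_apply split: if_splits)
    moreover have "u = v" if "word_prod (rev xs) u = word_prod (rev xs) v" for u v
      using that bij_is_inj[OF bij_word_prod] by (metis injD)
    ultimately show ?thesis by (metis not_le)
  qed
  then show "u \<le> k \<Longrightarrow> v \<le> k \<Longrightarrow> k < f u \<Longrightarrow> k < f v \<Longrightarrow> u = v"
    "k < u \<Longrightarrow> k < v \<Longrightarrow> f u \<le> k \<Longrightarrow> f v \<le> k \<Longrightarrow> u = v" by blast+
qed

text \<open>The boundary is crossed at one moment at most. Before it the positions up to
  \<open>k\<close> hold the values up to \<open>k\<close>, afterwards the values that end
  there.\<close>

lemma word_prod_prefix_crossing:
  assumes "length (filter (\<lambda>j. j = k) (pre @ suf)) \<le> 1"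
  shows "(\<forall>v. pos (word_prod pre) v \<le> k \<longleftrightarrow> v \<le> k)
    \<or> (\<forall>v. pos (word_prod pre) v \<le> k \<longleftrightarrow> pos (word_prod (pre @ suf)) v \<le> k)"
proof (cases "k \<in> set pre")
  case False
  then show ?thesis using word_prod_le_iff[of k "rev pre"] by (simp add: inv_word_prod)
next
  case True
  then have "filter (\<lambda>j. j = k) pre \<noteq> []" by (auto simp: filter_empty_conv)
  then have "filter (\<lambda>j. j = k) suf = []"
    using assms by (cases "filter (\<lambda>j. j = k) pre") auto
  then have "k \<notin> set (rev suf)" by (auto simp: filter_empty_conv)
  then have "pos (word_prod (pre @ suf)) v \<le> k \<longleftrightarrow> pos (word_prod pre) v \<le> k" for v
    using word_prod_le_iff[of k "rev suf"] unfolding inv_word_prod by simp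
  then show ?thesis by blast
qed

section \<open>Bounds on the letters exclude both kinds of crossing\<close>

lemma not_crossing_3412_if_letters_once:
  assumes "\<And>k. k \<in> {1..<n} \<Longrightarrow> f k < f (k + 1) \<Longrightarrow> length (filter (\<lambda>j. j = k) is) \<le> 1"
    and f: "f = pos (word_prod is)"
  shows "\<not> crossing_3412 n f"
proof
  assume "crossing_3412 n f"
  then obtain a b c d k where *: "1 \<le> a" "a < b" "b \<le> k" "k < c" "c < d" "d \<le> n"
    "max (f c) (f d) < min (f a) (f b)" "f k < f (k + 1)"
    unfolding crossing_3412_def by blast
  have once: "length (filter (\<lambda>j. j = k) is) \<le> 1"
    using * by (intro assms(1)) auto
  note unique = word_prod_crossing_unique[OF once, folded f]
  show False
  \<comment> \<open>Both \<open>c\<close> and \<open>d\<close> stand to the left of \<open>a\<close>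
    and \<open>b\<close>. Either both have moved down across \<open>k\<close>, or one of them ends
    above \<open>k\<close> and then both \<open>a\<close> and \<open>b\<close> have moved
    up.\<close>
  proof (cases "f c \<le> k \<and> f d \<le> k")
    case True
    then show False using unique(2)[of c d] * by auto
  next
    case False
    then show False using unique(1)[of a b] * by auto
  qed
qed

text \<open>Think of \<open>B\<close> as the block of \<open>y\<close>. Each \<open>u\<close> in
  \<open>B\<close> is inverted with \<open>x\<close> if \<open>y \<le> u\<close> and with
  \<open>z\<close> otherwise, which gives \<open>?Q\<close>; the pairs \<open>(y, z)\<close> and
  \<open>(x, z)\<close> are two more.\<close>

lemma card_ordered_pairs_insert:
  assumes "y \<in> B" "finite B"
    and anti: "\<And>u v. u \<in> B \<Longrightarrow> v \<in> B \<Longrightarrow> u < v \<Longrightarrow> f v < f u"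
    and B: "\<And>u. u \<in> B \<Longrightarrow> x < u \<and> u < z"
    and f: "f z < f y" "f y < f x"
  shows "card {(u, v). u \<in> B \<and> v \<in> B \<and> u < v} + card B + 2
    \<le> card (inversions (insert x (insert z B)) f)"
proof -
  let ?P = "{(u, v). u \<in> B \<and> v \<in> B \<and> u < v}"
  let ?Q = "(\<lambda>u. if y \<le> u then (x, u) else (u, z)) ` B"
  have xyz: "x < y" "y < z" "x \<notin> B" "z \<notin> B" using B assms(1) by blast+
  have "finite ?P" using assms(2) by (auto intro: finite_subset[of _ "B \<times> B"])
  have cQ: "card ?Q = card B"
    using xyz(3,4) by (intro card_image inj_onI) (auto split: if_splits)
  have "?P \<inter> ?Q = {}" using xyz(3,4) by auto
  then have c1: "card (?P \<union> ?Q) = card ?P + card B"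
    using \<open>finite ?P\<close> assms(2) cQ by (subst card_Un_disjoint) auto
  have ne: "(y, z) \<notin> ?P \<union> ?Q" "(x, z) \<notin> insert (y, z) (?P \<union> ?Q)"
    using xyz by (auto split: if_splits)
  have fin: "finite (?P \<union> ?Q)" using \<open>finite ?P\<close> assms(2) by simp
  have new: "card (insert (x, z) (insert (y, z) (?P \<union> ?Q))) = card ?P + card B + 2"
    using fin ne c1 by simp
  have sub: "insert (x, z) (insert (y, z) (?P \<union> ?Q)) \<subseteq> inversions (insert x (insert z B)) f"
  proof -
    have "f u < f x" if "u \<in> B" "y \<le> u" for u
      using that anti[of y u] assms(1) f by (cases "u = y") auto
    moreover have "f z < f u" if "u \<in> B" "\<not> y \<le> u" for u
      using that anti[of u y] assms(1) f by auto
    moreover have "x < z" "f z < f x" using xyz(1,2) f by auto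
    ultimately show ?thesis
      using anti B assms(1) f(1) by (auto simp: inversions_def)
  qed
  have "finite (inversions (insert x (insert z B)) f)"
    using assms(2) by (intro finite_inversions) simp
  from card_mono[OF this sub] show ?thesis unfolding new .
qed

lemma length_filter_interval:
  fixes k l :: nat
  assumes "k < l"
  shows "length (filter (\<lambda>j. j \<in> {k..l}) is) = length (filter (\<lambda>j. j = k) is)
    + length (filter (\<lambda>j. j \<in> {k + 1..<l}) is) + length (filter (\<lambda>j. j = l) is)"
  using assms by (induction "is") auto

text \<open>Besides the values in the block of \<open>y\<close> only \<open>x\<close> and \<open>z\<close> are followed. A letter outside
  \<open>{k..l}\<close> never exchanges two of these \<open>|B| + 2\<close> values, because at any time at most one of them
  is at a position \<open>\<le> k\<close> and at most one at a position \<open>> l\<close>.\<close>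

lemma not_crossing_321_if_few_letters:
  assumes once: "\<And>k. k \<in> {1..<n} \<Longrightarrow> f k < f (k + 1) \<Longrightarrow> length (filter (\<lambda>j. j = k) is) \<le> 1"
    and few: "\<And>a b. 1 \<le> a \<Longrightarrow> a < b \<Longrightarrow> b < n \<Longrightarrow> f (a - 1) < f a \<Longrightarrow> f b < f (b + 1) \<Longrightarrow>
       (\<And>i. i \<in> {a..<b} \<Longrightarrow> f (i + 1) < f i) \<Longrightarrow>
       length (filter (\<lambda>j. j \<in> {a..<b}) is)
         \<le> card {(u, v). u \<in> {a..b} \<and> v \<in> {a..b} \<and> u < v} + (b - a)"
    and f: "f = pos (word_prod is)"
  shows "\<not> crossing_321 n f"
proof
  assume "crossing_321 n f"
  then obtain x y z k0 l0 where *: "1 \<le> x" "x \<le> k0" "k0 < y" "y \<le> l0" "l0 < z" "z \<le> n"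
    "f z < f y" "f y < f x" "f k0 < f (k0 + 1)" "f l0 < f (l0 + 1)"
    unfolding crossing_321_def by blast
  have inj: "inj f" unfolding f inv_word_prod by (intro bij_is_inj bij_word_prod)
  have neq: "f i \<noteq> f (i + 1)" for i
    using inj by (metis inj_eq n_not_Suc_n Suc_eq_plus1)
  \<comment> \<open>\<open>k\<close> and \<open>l\<close> are the boundaries nearest to
    \<open>y\<close>, so \<open>{k + 1..l}\<close> is its whole block, and \<open>x\<close> and
    \<open>z\<close> remain on either side of it.\<close>
  define k where "k = (GREATEST k. k < y \<and> f k < f (k + 1))"
  define l where "l = (LEAST l. y \<le> l \<and> f l < f (l + 1))"
  have k: "k < y \<and> f k < f (k + 1)"
    unfolding k_def by (rule GreatestI_nat[where b = y]) (use * in auto)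
  have k_max: "i \<le> k" if "i < y" "f i < f (i + 1)" for i
    unfolding k_def using that by (intro Greatest_le_nat[where b = y]) auto
  have l: "y \<le> l \<and> f l < f (l + 1)"
    unfolding l_def by (rule LeastI[of _ l0]) (use * in auto)
  have l_min: "l \<le> i" if "y \<le> i" "f i < f (i + 1)" for i
    unfolding l_def using that by (intro Least_le) auto
  have bounds: "x \<le> k" "l < z" "k < l" using k_max[of k0] l_min[of l0] * k l by auto
  have desc: "f (i + 1) < f i" if "i \<in> {k + 1..<l}" for i
  proof -
    have "\<not> f i < f (i + 1)" using that k_max[of i] l_min[of i] by (cases "i < y") auto
    then show ?thesis using neq[of i] by (simp add: nat_neq_iff)
  qed
  define B where "B = {k + 1..l}"
  have anti: "f v < f u" if "u \<in> B" "v \<in> B" "u < v" for u v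
  proof -
    have "u + 1 \<le> v" using that by simp
    then show ?thesis using that(2)
    proof (induction v rule: dec_induct)
      case base
      then show ?case using desc[of u] that unfolding B_def by auto
    next
      case (step v)
      then show ?case using desc[of v] that unfolding B_def by auto
    qed
  qed
  have once_k: "length (filter (\<lambda>j. j = k) is) \<le> 1"
    using k l bounds * by (intro once) auto
  have once_l: "length (filter (\<lambda>j. j = l) is) \<le> 1"
    using k l bounds * by (intro once) auto
  note unique_k = word_prod_crossing_unique[OF once_k, folded f]
    and unique_l = word_prod_crossing_unique[OF once_l, folded f]
  \<comment> \<open>Otherwise \<open>y\<close> and \<open>z\<close>, which stand to the left of
    \<open>x\<close>, would both cross \<open>k\<close> downwards. \<open>fz\<close> is the mirror
    image at \<open>l\<close>.\<close>
  have fx: "k < f x"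
  proof (rule ccontr)
    assume "\<not> k < f x"
    then show False using unique_k(2)[of y z] * k l bounds by auto
  qed
  have fz: "f z \<le> l"
  proof (rule ccontr)
    assume "\<not> f z \<le> l"
    then show False using unique_l(1)[of x y] * k l bounds by auto
  qed
  define S where "S = insert x (insert z B)"
  have "card (inversions S f) \<le> length (filter (\<lambda>j. j \<in> {k..l}) is)"
    unfolding f
  proof (rule inversions_word_le)
    show "finite S" by (simp add: S_def B_def)
    fix pre j suf assume split: "is = pre @ j # suf"
    define p where "p = pos (word_prod pre)"
    have p: "p (word_prod pre u) = u" for u
      unfolding p_def by (intro inv_f_f bij_is_inj bij_word_prod)
    show "j \<in> {k..l} \<or> word_prod pre j \<notin> S \<or> word_prod pre (j + 1) \<notin> S"
    proof (rule ccontr)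
      assume "\<not> ?thesis"
      then obtain u v where uv: "u \<in> S" "v \<in> S" "p u = j" "p v = j + 1" "j \<notin> {k..l}"
        using p by blast
      then have "u \<noteq> v" by auto
      from uv(5) consider "j < k" | "l < j" by fastforce
      then show False
      proof cases
        case 1
        then have "p u \<le> k" "p v \<le> k" using uv by auto
        \<comment> \<open>At this moment the positions up to \<open>k\<close> hold either the values
          that start there or those that end there. In \<open>S\<close> the former are just
          \<open>x\<close>; the latter exclude \<open>x\<close>, so they have crossed
          \<open>k\<close> and at most one exists.\<close>
        then have "u \<le> k \<and> v \<le> k \<or> f u \<le> k \<and> f v \<le> k"
          using word_prod_prefix_crossing[of k pre "j # suf"] once_k
          unfolding split[symmetric] p_def[symmetric] f[symmetric] by blast
        then show False
        proof
          assume "u \<le> k \<and> v \<le> k"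
          then show False using uv(1,2) \<open>u \<noteq> v\<close> bounds unfolding S_def B_def by auto
        next
          assume le: "f u \<le> k \<and> f v \<le> k"
          then have "u \<noteq> x" "v \<noteq> x" using fx by auto
          then have "k < u" "k < v" using uv(1,2) bounds unfolding S_def B_def by auto
          then show False using unique_k(2)[of u v] le \<open>u \<noteq> v\<close> by auto
        qed
      next
        case 2
        then have "\<not> p u \<le> l" "\<not> p v \<le> l" using uv by auto
        then have "\<not> u \<le> l \<and> \<not> v \<le> l \<or> \<not> f u \<le> l \<and> \<not> f v \<le> l"
          using word_prod_prefix_crossing[of l pre "j # suf"] once_l
          unfolding split[symmetric] p_def[symmetric] f[symmetric] by blast
        then show False
        proof
          assume "\<not> u \<le> l \<and> \<not> v \<le> l"
          then show False using uv(1,2) \<open>u \<noteq> v\<close> bounds unfolding S_def B_def by auto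
        next
          assume le: "\<not> f u \<le> l \<and> \<not> f v \<le> l"
          then have "u \<noteq> z" "v \<noteq> z" using fz by auto
          then have "u \<le> l" "v \<le> l" using uv(1,2) bounds unfolding S_def B_def by auto
          then show False using unique_l(1)[of u v] le \<open>u \<noteq> v\<close> by auto
        qed
      qed
    qed
  qed
  also have "\<dots> \<le> length (filter (\<lambda>j. j \<in> {k + 1..<l}) is) + 2"
    using length_filter_interval[OF bounds(3), of "is"] once_k once_l by simp
  \<comment> \<open>A block of one value has no letters of its own and is no component, so (S.2)
    enters only for larger blocks.\<close>
  also have "\<dots> \<le> card {(u, v). u \<in> B \<and> v \<in> B \<and> u < v} + (l - (k + 1)) + 2"
  proof (cases "k + 1 < l")
    case True
    then show ?thesis
      using few[of "k + 1" l] desc k l bounds * unfolding B_def by simp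
  next
    case False
    then show ?thesis by simp
  qed
  finally have "card (inversions S f) \<le> card {(u, v). u \<in> B \<and> v \<in> B \<and> u < v} + (l - (k + 1)) + 2" .
  moreover have "card {(u, v). u \<in> B \<and> v \<in> B \<and> u < v} + card B + 2 \<le> card (inversions S f)"
    unfolding S_def
    by (rule card_ordered_pairs_insert[where y = y])
      (use * k l bounds anti in \<open>auto simp: B_def\<close>)
  \<comment> \<open>As \<open>B\<close> has \<open>l - k\<close> elements, the lower bound exceeds
    the upper bound by exactly one.\<close>
  ultimately show False using bounds(3) by (simp add: B_def)
qed

subsection \<open>The twenty one patterns\<close>

text \<open>The argument \<open>p\<^sub>i\<close> is the position of the \<open>i\<close>-th smallest of the five values.\<close>

definition pattern_order :: "nat \<Rightarrow> nat \<Rightarrow> nat \<Rightarrow> nat \<Rightarrow> nat \<Rightarrow> bool" where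
  "pattern_order p1 p2 p3 p4 p5 \<longleftrightarrow>
     (p2 < p4 \<and> p4 < p5 \<and> p5 < p3 \<and> p3 < p1) \<or>
     (p2 < p5 \<and> p5 < p3 \<and> p3 < p1 \<and> p1 < p4) \<or>
     (p2 < p5 \<and> p5 < p3 \<and> p3 < p4 \<and> p4 < p1) \<or>
     (p3 < p4 \<and> p4 < p5 \<and> p5 < p1 \<and> p1 < p2) \<or>
     (p3 < p4 \<and> p4 < p5 \<and> p5 < p2 \<and> p2 < p1) \<or>
     (p3 < p5 \<and> p5 < p4 \<and> p4 < p1 \<and> p1 < p2) \<or>
     (p3 < p5 \<and> p5 < p4 \<and> p4 < p2 \<and> p2 < p1) \<or>
     (p4 < p2 \<and> p2 < p5 \<and> p5 < p3 \<and> p3 < p1) \<or>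
     (p4 < p5 \<and> p5 < p1 \<and> p1 < p2 \<and> p2 < p3) \<or>
     (p4 < p5 \<and> p5 < p2 \<and> p2 < p1 \<and> p1 < p3) \<or>
     (p4 < p5 \<and> p5 < p2 \<and> p2 < p3 \<and> p3 < p1) \<or>
     (p4 < p5 \<and> p5 < p3 \<and> p3 < p1 \<and> p1 < p2) \<or>
     (p5 < p2 \<and> p2 < p3 \<and> p3 < p1 \<and> p1 < p4) \<or>
     (p5 < p2 \<and> p2 < p3 \<and> p3 < p4 \<and> p4 < p1) \<or>
     (p5 < p3 \<and> p3 < p1 \<and> p1 < p2 \<and> p2 < p4) \<or>
     (p5 < p3 \<and> p3 < p1 \<and> p1 < p4 \<and> p4 < p2) \<or>
     (p5 < p3 \<and> p3 < p4 \<and> p4 < p1 \<and> p1 < p2) \<or>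
     (p5 < p3 \<and> p3 < p4 \<and> p4 < p2 \<and> p2 < p1) \<or>
     (p5 < p4 \<and> p4 < p1 \<and> p1 < p2 \<and> p2 < p3) \<or>
     (p5 < p4 \<and> p4 < p2 \<and> p2 < p1 \<and> p1 < p3) \<or>
     (p5 < p4 \<and> p4 < p2 \<and> p2 < p3 \<and> p3 < p1)"

text \<open>Passage from positions to values: \<open>V k\<close> is the value of \<open>w\<close> in
  the role of the entry \<open>k\<close>, and reading \<open>V\<close> along \<open>p\<close> must
  give increasing positions.\<close>

lemma contains_pattern_iff:
  assumes w: "w permutes {1..n}" and p: "distinct p" "set p = {1..length p}"
  shows "contains_pattern n w p \<longleftrightarrow> (\<exists>V. (\<forall>k \<in> set p. V k \<in> {1..n}) \<and>
    (\<forall>k \<in> set p. \<forall>l \<in> set p. k < l \<longrightarrow> V k < V l) \<and> sorted_wrt (<) (map (\<lambda>k. pos w (V k)) p))"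
proof
  assume "contains_pattern n w p"
  then obtain "is" where "is": "length is = length p" "set is \<subseteq> {1..n}" "sorted_wrt (<) is"
    and ord: "\<And>a b. a < length p \<Longrightarrow> b < length p \<Longrightarrow> w (is ! a) < w (is ! b) \<longleftrightarrow> p ! a < p ! b"
    unfolding contains_pattern_def by blast
  \<comment> \<open>\<open>q\<close> inverts \<open>p\<close>: it gives the index at which an entry
    occurs.\<close>
  define q where "q k = (THE a. a < length p \<and> p ! a = k)" for k
  have q_nth: "q (p ! a) = a" if "a < length p" for a
    unfolding q_def using that p(1) by (intro the_equality) (auto simp: nth_eq_iff_index_eq)
  have q: "q k < length p \<and> p ! q k = k" if "k \<in> set p" for k
    using that q_nth by (auto simp: in_set_conv_nth)
  define V where "V k = w (is ! q k)" for k
  have "V k \<in> {1..n}" if "k \<in> set p" for k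
  proof -
    have "is ! q k \<in> {1..n}" using q[OF that] "is"(1,2) by (metis nth_mem subsetD)
    then show ?thesis unfolding V_def by (simp only: permutes_in_image[OF w])
  qed
  moreover have "V k < V l" if "k \<in> set p" "l \<in> set p" "k < l" for k l
    unfolding V_def using that q[of k] q[of l] ord[of "q k" "q l"] by simp
  moreover have "map (\<lambda>k. pos w (V k)) p = is"
    using "is"(1) w by (intro nth_equalityI) (auto simp: V_def q_nth permutes_inverses)
  ultimately show "\<exists>V. (\<forall>k \<in> set p. V k \<in> {1..n}) \<and>
    (\<forall>k \<in> set p. \<forall>l \<in> set p. k < l \<longrightarrow> V k < V l) \<and> sorted_wrt (<) (map (\<lambda>k. pos w (V k)) p)"
    using "is"(3) by (intro exI[of _ V]) simp
next
  assume "\<exists>V. (\<forall>k \<in> set p. V k \<in> {1..n}) \<and>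
    (\<forall>k \<in> set p. \<forall>l \<in> set p. k < l \<longrightarrow> V k < V l) \<and> sorted_wrt (<) (map (\<lambda>k. pos w (V k)) p)"
  then obtain V where V: "\<And>k. k \<in> set p \<Longrightarrow> V k \<in> {1..n}"
    "\<And>k l. k \<in> set p \<Longrightarrow> l \<in> set p \<Longrightarrow> k < l \<Longrightarrow> V k < V l"
    "sorted_wrt (<) (map (\<lambda>k. pos w (V k)) p)" by blast
  have iff: "V k < V l \<longleftrightarrow> k < l" if "k \<in> set p" "l \<in> set p" for k l
    using V(2)[of k l] V(2)[of l k] that by (cases k l rule: linorder_cases) auto
  have mem: "pos w v \<in> {1..n} \<longleftrightarrow> v \<in> {1..n}" for v
    by (rule permutes_in_image[OF permutes_inv[OF w]])
  show "contains_pattern n w p"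
    unfolding contains_pattern_def
  proof (intro exI conjI allI impI)
    show "set (map (\<lambda>k. pos w (V k)) p) \<subseteq> {1..n}"
      using V(1) mem unfolding set_map by blast
    show "sorted_wrt (<) (map (\<lambda>k. pos w (V k)) p)" by (rule V(3))
    fix a b assume "a < length p" "b < length p"
    then show "w (map (\<lambda>k. pos w (V k)) p ! a) < w (map (\<lambda>k. pos w (V k)) p ! b) \<longleftrightarrow> p ! a < p ! b"
      using iff w by (simp add: permutes_inverses)
  qed simp
qed

text \<open>The leading \<open>0\<close> of the list is a filler that makes its indices agree with
  the pattern entries 1 to 5.\<close>

lemma contains_pattern_5_iff:
  assumes "w permutes {1..n}" "distinct p" "set p = {1, 2, 3, 4, 5}"
  shows "contains_pattern n w p \<longleftrightarrow> (\<exists>v1 v2 v3 v4 v5. 1 \<le> v1 \<and> v1 < v2 \<and> v2 < v3 \<and> v3 < v4 \<and>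
    v4 < v5 \<and> v5 \<le> n \<and> sorted_wrt (<) (map (\<lambda>k. pos w ([0, v1, v2, v3, v4, v5] ! k)) p))"
proof -
  have "length p = 5" using assms(2,3) distinct_card[of p] by simp
  moreover have "{1, 2, 3, 4, 5} = {1..5::nat}" by auto
  ultimately have p: "set p = {1..length p}" using assms(3) by simp
  show ?thesis
    unfolding contains_pattern_iff[OF assms(1,2) p]
  proof
    assume "\<exists>V. (\<forall>k \<in> set p. V k \<in> {1..n}) \<and>
      (\<forall>k \<in> set p. \<forall>l \<in> set p. k < l \<longrightarrow> V k < V l) \<and> sorted_wrt (<) (map (\<lambda>k. pos w (V k)) p)"
    then obtain V where V: "\<forall>k \<in> set p. V k \<in> {1..n}"
      "\<forall>k \<in> set p. \<forall>l \<in> set p. k < l \<longrightarrow> V k < V l" "sorted_wrt (<) (map (\<lambda>k. pos w (V k)) p)"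
      by blast
    have less: "V 1 < V 2" "V 2 < V 3" "V 3 < V 4" "V 4 < V 5"
      using V(2) by (simp_all add: assms(3))
    have mem: "1 \<le> V 1" "V 5 \<le> n"
      using V(1) by (simp_all add: assms(3))
    have eq: "map (\<lambda>k. pos w ([0, V 1, V 2, V 3, V 4, V 5] ! k)) p = map (\<lambda>k. pos w (V k)) p"
      using assms(3) by (intro map_cong) auto
    show "\<exists>v1 v2 v3 v4 v5. 1 \<le> v1 \<and> v1 < v2 \<and> v2 < v3 \<and> v3 < v4 \<and>
      v4 < v5 \<and> v5 \<le> n \<and> sorted_wrt (<) (map (\<lambda>k. pos w ([0, v1, v2, v3, v4, v5] ! k)) p)"
      using mem less V(3)
      by (intro exI[of _ "V 1"] exI[of _ "V 2"] exI[of _ "V 3"] exI[of _ "V 4"] exI[of _ "V 5"])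
        (simp only: eq simp_thms)
  next
    assume "\<exists>v1 v2 v3 v4 v5. 1 \<le> v1 \<and> v1 < v2 \<and> v2 < v3 \<and> v3 < v4 \<and>
      v4 < v5 \<and> v5 \<le> n \<and> sorted_wrt (<) (map (\<lambda>k. pos w ([0, v1, v2, v3, v4, v5] ! k)) p)"
    then obtain v1 v2 v3 v4 v5 where v: "1 \<le> v1" "v1 < v2" "v2 < v3" "v3 < v4" "v4 < v5" "v5 \<le> n"
      "sorted_wrt (<) (map (\<lambda>k. pos w ([0, v1, v2, v3, v4, v5] ! k)) p)" by blast
    then show "\<exists>V. (\<forall>k \<in> set p. V k \<in> {1..n}) \<and>
      (\<forall>k \<in> set p. \<forall>l \<in> set p. k < l \<longrightarrow> V k < V l) \<and> sorted_wrt (<) (map (\<lambda>k. pos w (V k)) p)"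
      by (intro exI[of _ "\<lambda>k. [0, v1, v2, v3, v4, v5] ! k"]) (simp add: assms(3))
  qed
qed

lemma contains_spherical_pattern_iff:
  assumes "w permutes {1..n}"
  shows "(\<exists>p \<in> spherical_patterns. contains_pattern n w p) \<longleftrightarrow>
    (\<exists>v1 v2 v3 v4 v5. 1 \<le> v1 \<and> v1 < v2 \<and> v2 < v3 \<and> v3 < v4 \<and> v4 < v5 \<and> v5 \<le> n \<and>
       pattern_order (pos w v1) (pos w v2) (pos w v3) (pos w v4) (pos w v5))"
proof -
  have sorted5: "sorted_wrt (<) [a, b, c, d, e] \<longleftrightarrow> a < b \<and> b < c \<and> c < d \<and> d < e" for a b c d e :: nat
    by auto
  have order: "(\<exists>p \<in> spherical_patterns. sorted_wrt (<) (map (\<lambda>k. pos w ([0, v1, v2, v3, v4, v5] ! k)) p))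
      \<longleftrightarrow> pattern_order (pos w v1) (pos w v2) (pos w v3) (pos w v4) (pos w v5)" for v1 v2 v3 v4 v5
    unfolding spherical_patterns_def pattern_order_def bex_simps
    by (simp add: sorted5 del: sorted_wrt.simps)
  have "distinct p \<and> set p = {1, 2, 3, 4, 5}" if "p \<in> spherical_patterns" for p
    using that unfolding spherical_patterns_def by (elim insertE; simp) fast+
  then have "(\<exists>p \<in> spherical_patterns. contains_pattern n w p) \<longleftrightarrow>
    (\<exists>p \<in> spherical_patterns. \<exists>v1 v2 v3 v4 v5. 1 \<le> v1 \<and> v1 < v2 \<and> v2 < v3 \<and> v3 < v4 \<and>
      v4 < v5 \<and> v5 \<le> n \<and> sorted_wrt (<) (map (\<lambda>k. pos w ([0, v1, v2, v3, v4, v5] ! k)) p))"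
    using contains_pattern_5_iff[OF assms] by blast
  also have "\<dots> \<longleftrightarrow> (\<exists>v1 v2 v3 v4 v5. 1 \<le> v1 \<and> v1 < v2 \<and> v2 < v3 \<and> v3 < v4 \<and> v4 < v5 \<and> v5 \<le> n \<and>
    (\<exists>p \<in> spherical_patterns. sorted_wrt (<) (map (\<lambda>k. pos w ([0, v1, v2, v3, v4, v5] ! k)) p)))"
    by blast
  finally show ?thesis unfolding order .
qed

section \<open>Translation between patterns and crossings\<close>

lemma ascent_between:
  fixes f :: "nat \<Rightarrow> nat"
  assumes "x < y" "f x < f y"
  shows "\<exists>k. x \<le> k \<and> k < y \<and> f k < f (k + 1)"
proof (rule ccontr)
  assume "\<not> ?thesis"
  then have desc: "f (k + 1) \<le> f k" if "x \<le> k" "k < y" for k using that by (meson not_le)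
  have "f z \<le> f x" if "x \<le> z" "z \<le> y" for z
    using that
  proof (induction z rule: dec_induct)
    case (step z)
    then show ?case using desc[of z] by simp
  qed simp
  from this[of y] assms show False by simp
qed

text \<open>Two values that stand in increasing order have an ascent between them, so
  \<open>a\<close>, \<open>b\<close> and \<open>c\<close>, \<open>d\<close> supply the
  boundaries.\<close>

lemma crossing_321I:
  assumes "1 \<le> x" "x \<le> a" "a < b" "b \<le> y" "y \<le> c" "c < d" "d \<le> z" "z \<le> n"
    "f z < f y" "f y < f x" "f a < f b" "f c < f d"
  shows "crossing_321 n f"
proof -
  obtain k where "a \<le> k" "k < b" "f k < f (k + 1)" using ascent_between[of a b f] assms by blast
  moreover obtain l where "c \<le> l" "l < d" "f l < f (l + 1)" using ascent_between[of c d f] assms by blast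
  ultimately show ?thesis
    unfolding crossing_321_def using assms
    by (intro exI[of _ x] exI[of _ y] exI[of _ z] exI[of _ k] exI[of _ l] conjI) linarith+
qed

lemma crossing_3412I:
  assumes "1 \<le> a" "a < b" "b \<le> x" "x < y" "y \<le> c" "c < d" "d \<le> n"
    "f c < f a" "f c < f b" "f d < f a" "f d < f b" "f x < f y"
  shows "crossing_3412 n f"
proof -
  obtain k where "x \<le> k" "k < y" "f k < f (k + 1)" using ascent_between[of x y f] assms by blast
  then show ?thesis
    unfolding crossing_3412_def using assms
    by (intro exI[of _ a] exI[of _ b] exI[of _ c] exI[of _ d] exI[of _ k] conjI)
      (linarith | simp only: max_less_iff_conj min_less_iff_conj)+
qed

text \<open>In each pattern either \<open>v1\<close>, \<open>v3\<close>, \<open>v5\<close> form a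
  321 and \<open>v2\<close>, \<open>v4\<close> witness a boundary on each side of \<open>v3\<close>,
  or \<open>v1\<close>, \<open>v2\<close>, \<open>v4\<close>, \<open>v5\<close> form a 3412, up to
  order within the two pairs, and \<open>v3\<close> witnesses the boundary.\<close>

lemma crossing_if_pattern_order:
  assumes v: "1 \<le> v1" "v1 < v2" "v2 < v3" "v3 < v4" "v4 < v5" "v5 \<le> n"
    and order: "pattern_order (f v1) (f v2) (f v3) (f v4) (f v5)"
  shows "crossing_321 n f \<or> crossing_3412 n f"
proof (rule ccontr)
  assume no: "\<not> ?thesis"
  have "\<not> (f a < f b \<and> f c < f d \<and> f v5 < f v3 \<and> f v3 < f v1)"
    if "(a, b) \<in> {(v1, v2), (v2, v3)}" "(c, d) \<in> {(v3, v4), (v4, v5)}" for a b c d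
    using crossing_321I[of v1 a b v3 c d v5 n f] no that v by auto
  then have "\<not> (f v1 < f v2 \<and> f v3 < f v4 \<and> f v5 < f v3 \<and> f v3 < f v1)"
    "\<not> (f v1 < f v2 \<and> f v4 < f v5 \<and> f v5 < f v3 \<and> f v3 < f v1)"
    "\<not> (f v2 < f v3 \<and> f v3 < f v4 \<and> f v5 < f v3 \<and> f v3 < f v1)"
    "\<not> (f v2 < f v3 \<and> f v4 < f v5 \<and> f v5 < f v3 \<and> f v3 < f v1)"
    by blast+
  moreover have "\<not> (f x < f y \<and> f v4 < f v1 \<and> f v4 < f v2 \<and> f v5 < f v1 \<and> f v5 < f v2)"
    if "(x, y) \<in> {(v2, v3), (v3, v4)}" for x y
    using crossing_3412I[of v1 v2 x y v4 v5 n f] no that v by auto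
  then have "\<not> (f v2 < f v3 \<and> f v4 < f v1 \<and> f v4 < f v2 \<and> f v5 < f v1 \<and> f v5 < f v2)"
    "\<not> (f v3 < f v4 \<and> f v4 < f v1 \<and> f v4 < f v2 \<and> f v5 < f v1 \<and> f v5 < f v2)"
    by blast+
  ultimately show False
    using order unfolding pattern_order_def by (elim disjE conjE) simp_all
qed

text \<open>In the chain \<open>p5 < p3 < p1\<close> the ascents keep \<open>p2\<close> out of the
  gap from \<open>p3\<close> to \<open>p1\<close> and \<open>p4\<close> out of the gap from
  \<open>p5\<close> to \<open>p3\<close>. Three places remain for each; when both come first or both
  last, two orders are possible, so there are eleven patterns.\<close>

lemma pattern_order_321:
  assumes "p5 < p3" "p3 < p1" "p2 < p3 \<or> p1 < p2" "p3 < p4 \<or> p4 < p5"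
    "p1 \<noteq> p4" "p2 \<noteq> p4" "p2 \<noteq> p5"
  shows "pattern_order p1 p2 p3 p4 p5"
proof -
  have "p2 < p5 \<or> p5 < p2 \<and> p2 < p3 \<or> p1 < p2" "p4 < p5 \<or> p3 < p4 \<and> p4 < p1 \<or> p1 < p4"
    using assms by linarith+
  moreover have "p2 < p4 \<or> p4 < p2" using assms by linarith
  ultimately show ?thesis
    using assms(1,2) unfolding pattern_order_def by (elim disjE conjE) simp_all
qed

text \<open>Twelve orders satisfy the assumptions; two of them, 45231 and 53412, are also among the
  eleven of \<open>pattern_order_321\<close>.\<close>

lemma pattern_order_3412:
  assumes "p4 < p1" "p4 < p2" "p5 < p1" "p5 < p2" "p2 < p3 \<or> p3 < p4"
    "p1 \<noteq> p2" "p1 \<noteq> p3" "p3 \<noteq> p5" "p4 \<noteq> p5"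
  shows "pattern_order p1 p2 p3 p4 p5"
proof -
  have "p1 < p2 \<or> p2 < p1" "p1 < p3 \<or> p3 < p1" "p3 < p5 \<or> p5 < p3" "p4 < p5 \<or> p5 < p4"
    using assms by linarith+
  then show ?thesis
    using assms(1-5) unfolding pattern_order_def by (elim disjE conjE) simp_all
qed

lemma pattern_order_if_crossing_321:
  fixes f :: "nat \<Rightarrow> nat"
  assumes inj: "inj f" and "crossing_321 n f"
  shows "\<exists>v1 v2 v3 v4 v5. 1 \<le> v1 \<and> v1 < v2 \<and> v2 < v3 \<and> v3 < v4 \<and> v4 < v5 \<and> v5 \<le> n \<and>
    pattern_order (f v1) (f v2) (f v3) (f v4) (f v5)"
proof -
  have neq: "f u \<noteq> f v" if "u < v" for u v using inj that by (metis injD nat_less_le)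
  obtain x y z k l where *: "1 \<le> x" "x \<le> k" "k < y" "y \<le> l" "l < z" "z \<le> n"
    "f z < f y" "f y < f x" "f k < f (k + 1)" "f l < f (l + 1)"
    using assms(2) unfolding crossing_321_def by blast
  \<comment> \<open>One value \<open>d\<close> is to witness the boundary: \<open>k + 1\<close> if
    it stands after \<open>x\<close>, or \<open>k\<close> if it stands before \<open>y\<close>.
    Otherwise \<open>k\<close> stands after \<open>y\<close> and can replace \<open>x\<close>, with
    \<open>k + 1\<close> as witness.\<close>
  obtain x' d where x': "1 \<le> x'" "x' < d" "d < y" "f y < f x'" "f d < f y \<or> f x' < f d"
  proof -
    consider "f x < f (k + 1)" | "f (k + 1) \<le> f x" "f k < f y" | "f (k + 1) \<le> f x" "f y \<le> f k"
      by linarith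
    then show thesis
    proof cases
      case 1
      then have "k + 1 \<noteq> y" using * by auto
      then show ?thesis using that[of x "k + 1"] 1 * by auto
    next
      case 2
      then have "k \<noteq> x" using * by auto
      then show ?thesis using that[of x k] 2 * by auto
    next
      case 3
      then have "k + 1 \<noteq> y" "f y < f k" using * neq[of k y] by auto
      then show ?thesis using that[of k "k + 1"] 3 * by auto
    qed
  qed
  \<comment> \<open>The mirror image: the witness is \<open>l + 1\<close> or \<open>l\<close>, or
    else \<open>l + 1\<close> replaces \<open>z\<close> with \<open>l\<close> as witness.\<close>
  obtain e z' where z': "y < e" "e < z'" "z' \<le> n" "f z' < f y" "f y < f e \<or> f e < f z'"
  proof -
    consider "f y < f (l + 1)" | "f (l + 1) \<le> f y" "f l < f z" | "f (l + 1) \<le> f y" "f z \<le> f l"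
      by linarith
    then show thesis
    proof cases
      case 1
      then have "l + 1 \<noteq> z" using * by auto
      then show ?thesis using that[of "l + 1" z] 1 * by auto
    next
      case 2
      then have "l \<noteq> y" using * by auto
      then show ?thesis using that[of l z] 2 * by auto
    next
      case 3
      then have "f (l + 1) < f y" "l \<noteq> y" using * neq[of y "l + 1"] by auto
      then show ?thesis using that[of l "l + 1"] 3 * by auto
    qed
  qed
  have "pattern_order (f x') (f d) (f y) (f e) (f z')"
    using x' z' neq[of x' e] neq[of d e] neq[of d z'] by (intro pattern_order_321) auto
  then show ?thesis using x' z' by blast
qed

lemma pattern_order_if_crossing_3412:
  fixes f :: "nat \<Rightarrow> nat"
  assumes inj: "inj f" and "crossing_3412 n f"
  shows "\<exists>v1 v2 v3 v4 v5. 1 \<le> v1 \<and> v1 < v2 \<and> v2 < v3 \<and> v3 < v4 \<and> v4 < v5 \<and> v5 \<le> n \<and>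
    pattern_order (f v1) (f v2) (f v3) (f v4) (f v5)"
proof -
  have neq: "f u \<noteq> f v" if "u < v" for u v using inj that by (metis injD nat_less_le)
  obtain a b c d k where *: "1 \<le> a" "a < b" "b \<le> k" "k < c" "c < d" "d \<le> n"
    "f c < f a" "f c < f b" "f d < f a" "f d < f b" "f k < f (k + 1)"
    using assms(2) unfolding crossing_3412_def by auto
  have base: ?thesis
    if "1 \<le> v1" "v1 < v2" "v2 < v3" "v3 < v4" "v4 < v5" "v5 \<le> n"
      "f v4 < f v1" "f v4 < f v2" "f v5 < f v1" "f v5 < f v2" "f v2 < f v3 \<or> f v3 < f v4"
    for v1 v2 v3 v4 v5
  proof -
    have "pattern_order (f v1) (f v2) (f v3) (f v4) (f v5)"
      using that neq[of v1 v2] neq[of v1 v3] neq[of v3 v5] neq[of v4 v5]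
      by (intro pattern_order_3412) auto
    then show ?thesis using that by blast
  qed
  consider "f b < f (k + 1)" | "f k < f c" | "f (k + 1) \<le> f b" "f c \<le> f k" by linarith
  then show ?thesis
  proof cases
    case 1
    then have "k + 1 \<noteq> c" using * by auto
    then show ?thesis using base[of a b "k + 1" c d] 1 * by auto
  next
    case 2
    then have "k \<noteq> b" using * by auto
    then show ?thesis using base[of a b k c d] 2 * by auto
  next
    case 3
    then have lt: "f c < f k" "f (k + 1) < f b"
      using * neq[of k c] neq[of b "k + 1"] by auto
    then have ne: "k \<noteq> b" "k + 1 \<noteq> c" using * by auto
    \<comment> \<open>Now \<open>k\<close> and \<open>k + 1\<close> stand between \<open>c\<close>
      and \<open>b\<close>. If \<open>d\<close> stands before \<open>k\<close>, then
      \<open>b\<close>, \<open>k\<close> replace \<open>a\<close>, \<open>b\<close>; if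
      \<open>k + 1\<close> stands before \<open>a\<close>, then \<open>k + 1\<close>,
      \<open>d\<close> replace \<open>c\<close>, \<open>d\<close>.\<close>
    consider "f d < f k" | "f k < f d" "f (k + 1) < f a" | "f k < f d" "f a < f (k + 1)"
      using neq[of k d] neq[of a "k + 1"] * by fastforce
    then show ?thesis
    proof cases
      case 1
      then show ?thesis using base[of b k "k + 1" c d] lt ne * by auto
    next
      case 2
      then show ?thesis using base[of a b k "k + 1" d] lt ne * by auto
    next
      case 3
      \<comment> \<open>The remaining order is \<open>c\<close>, \<open>k\<close>, \<open>a\<close>,
        \<open>k + 1\<close>, \<open>b\<close>, the pattern 53142, which is of the 321 kind.\<close>
      then have order: "f k < f a" "f a < f (k + 1)" using * by simp_all
      have "pattern_order (f a) (f b) (f k) (f (k + 1)) (f c)"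
        unfolding pattern_order_def using lt order by simp
      then show ?thesis using ne *
        by (intro exI[of _ a] exI[of _ b] exI[of _ k] exI[of _ "k + 1"] exI[of _ c] conjI)
          (assumption | linarith)+
    qed
  qed
qed

lemma avoids_spherical_patterns_iff:
  assumes "w permutes {1..n}"
  shows "(\<forall>p \<in> spherical_patterns. avoids n w p) \<longleftrightarrow>
    \<not> crossing_321 n (pos w) \<and> \<not> crossing_3412 n (pos w)"
proof -
  have inj: "inj (pos w)"
    using assms by (intro bij_is_inj permutes_bij permutes_inv)
  have "(\<exists>p \<in> spherical_patterns. contains_pattern n w p) \<longleftrightarrow>
    crossing_321 n (pos w) \<or> crossing_3412 n (pos w)"
    unfolding contains_spherical_pattern_iff[OF assms]
  proof
    assume "crossing_321 n (pos w) \<or> crossing_3412 n (pos w)"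
    then show "\<exists>v1 v2 v3 v4 v5. 1 \<le> v1 \<and> v1 < v2 \<and> v2 < v3 \<and> v3 < v4 \<and> v4 < v5 \<and> v5 \<le> n \<and>
       pattern_order (pos w v1) (pos w v2) (pos w v3) (pos w v4) (pos w v5)"
      using pattern_order_if_crossing_321[OF inj] pattern_order_if_crossing_3412[OF inj] by (elim disjE)
  qed (elim exE conjE, rule crossing_if_pattern_order)
  then show ?thesis unfolding avoids_def by blast
qed

subsection \<open>Permutations avoiding 321 and 3412\<close>

text \<open>Points outside \<open>{1..n}\<close> are fixed and take part in no inversion, so the
  avoidance conditions below may range over all natural numbers.\<close>

lemma permutes_inversion_bound:
  assumes "u permutes {1..n::nat}" "i < j" "u j < u i"
  shows "1 \<le> i" "j \<le> n"
proof -
  have mem: "u k \<in> {1..n} \<longleftrightarrow> k \<in> {1..n}" for k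
    using assms(1) by (rule permutes_in_image)
  have fixed: "k \<notin> {1..n} \<Longrightarrow> u k = k" for k
    using assms(1) by (rule permutes_not_in)
  show "1 \<le> i" "j \<le> n"
    using mem[of i] mem[of j] fixed[of i] fixed[of j] assms(2,3)
    by (cases "i \<in> {1..n}"; cases "j \<in> {1..n}"; auto)+
qed

text \<open>For the induction: up to order isomorphism, \<open>v\<close> on \<open>{1..n}\<close> is
  \<open>u\<close> with one entry deleted, and \<open>\<sigma>\<close> embeds the remaining
  positions.\<close>

lemma avoids_321_3412_transfer:
  fixes u v :: "nat \<Rightarrow> nat"
  assumes v: "v permutes {1..n}"
    and \<sigma>: "\<And>i j. i < j \<Longrightarrow> j \<le> n \<Longrightarrow> \<sigma> i < \<sigma> j"
    and less: "\<And>i j. i \<le> n \<Longrightarrow> j \<le> n \<Longrightarrow> v i < v j \<longleftrightarrow> u (\<sigma> i) < u (\<sigma> j)"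
    and u321: "\<And>i j k. i < j \<Longrightarrow> j < k \<Longrightarrow> \<not> (u k < u j \<and> u j < u i)"
    and u3412: "\<And>i j k l. i < j \<Longrightarrow> j < k \<Longrightarrow> k < l \<Longrightarrow> \<not> (u k < u l \<and> u l < u i \<and> u i < u j)"
  shows "\<And>i j k. i < j \<Longrightarrow> j < k \<Longrightarrow> \<not> (v k < v j \<and> v j < v i)"
    and "\<And>i j k l. i < j \<Longrightarrow> j < k \<Longrightarrow> k < l \<Longrightarrow> \<not> (v k < v l \<and> v l < v i \<and> v i < v j)"
proof -
  fix i j k :: nat assume *: "i < j" "j < k"
  show "\<not> (v k < v j \<and> v j < v i)"
  proof
    assume v': "v k < v j \<and> v j < v i"
    then have "k \<le> n" using permutes_inversion_bound[OF v *(2)] by simp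
    then show False using u321[of "\<sigma> i" "\<sigma> j" "\<sigma> k"] \<sigma>[of i j] \<sigma>[of j k] less v' * by auto
  qed
next
  fix i j k l :: nat assume *: "i < j" "j < k" "k < l"
  show "\<not> (v k < v l \<and> v l < v i \<and> v i < v j)"
  proof
    assume v': "v k < v l \<and> v l < v i \<and> v i < v j"
    then have "l \<le> n" using permutes_inversion_bound[OF v, of j l] * by simp
    then show False
      using u3412[of "\<sigma> i" "\<sigma> j" "\<sigma> k" "\<sigma> l"] \<sigma>[of i j] \<sigma>[of j k] \<sigma>[of k l] less v' * by auto
  qed
qed

lemma permutes_Suc_fixed:
  assumes "u permutes {1..Suc n}" "u (Suc n) = Suc n"
  shows "u permutes {1..n}"
  using assms(1) by (rule permutes_superset) (use assms(2) in \<open>auto simp: le_Suc_eq\<close>)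

text \<open>
  Consider the position \<open>p\<close> of the largest value \<open>n + 1\<close>. Avoiding 321, the values after it increase.
  If \<open>p = n\<close>, then right multiplication by \<open>s\<^sub>n\<close> moves it to the end. If \<open>p < n\<close>, then avoiding 3412
  forces the last value to be \<open>n\<close>, and left multiplication by \<open>s\<^sub>n\<close> moves \<open>n + 1\<close> to the end.
\<close>

lemma distinct_word_if_avoids_321_3412:
  assumes "u permutes {1..n}"
    and "\<And>i j k. i < j \<Longrightarrow> j < k \<Longrightarrow> \<not> (u k < u j \<and> u j < u i)"
    and "\<And>i j k l. i < j \<Longrightarrow> j < k \<Longrightarrow> k < l \<Longrightarrow> \<not> (u k < u l \<and> u l < u i \<and> u i < u j)"
  shows "\<exists>is. set is \<subseteq> {1..<n} \<and> distinct is \<and> u = word_prod is \<and>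
    length is = card (inversions {1..n} (pos u))"
  using assms
proof (induction n arbitrary: u)
  case 0
  then have "u = word_prod []" by simp
  then show ?case by (intro exI[of _ "[]"]) (simp add: inversions_def)
next
  case (Suc n)
  let ?N = "Suc n"
  note perm = Suc.prems(1)
  have mem: "u i \<in> {1..?N} \<longleftrightarrow> i \<in> {1..?N}" for i
    using perm by (rule permutes_in_image)
  have inj: "u i = u j \<longleftrightarrow> i = j" for i j
    using permutes_inj[OF perm] by (auto dest: injD)
  have upper: "u i \<le> ?N" if "i \<le> ?N" for i
    using that mem[of i] permutes_not_in[OF perm, of i] by (cases "i = 0") auto
  define p where "p = pos u ?N"
  have up: "u p = ?N" unfolding p_def using perm by (simp add: permutes_inverses)
  then have p: "p \<in> {1..?N}" using mem[of p] by simp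
  have same: "inversions {1..?N} (pos v) = inversions {1..n} (pos v)" if "v permutes {1..n}" for v
    using inversions_permutes_subinterval[OF that, of ?N] by simp
  have from_p: "u j < u k" if "p < j" "j < k" "k \<le> ?N" for j k
  proof -
    have "u j < u p" using that up upper[of j] inj[of j p] by auto
    then have "\<not> u k < u j" using Suc.prems(2)[OF that(1,2)] by auto
    then show ?thesis using inj[of j k] that by simp
  qed
  have conclude: "\<exists>is. set is \<subseteq> {1..<?N} \<and> distinct is \<and> u = word_prod is \<and>
      length is = card (inversions {1..?N} (pos u))"
    if "set is \<subseteq> {1..<?N}" "distinct is" "u = word_prod is"
      "length is = card (inversions {1..?N} (pos u))" for "is"
    using that by blast
  consider "p = ?N" | "p = n" "1 \<le> n" | "p < n" "1 \<le> n" using p by fastforce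
  then show ?case
  proof cases
    case 1
    have u: "u permutes {1..n}" using perm up[unfolded 1] by (rule permutes_Suc_fixed)
    obtain "is" where "is": "set is \<subseteq> {1..<n}" "distinct is" "u = word_prod is"
      "length is = card (inversions {1..n} (pos u))"
      using Suc.IH[OF u Suc.prems(2,3)] by blast
    have "{1..<n} \<subseteq> {1..<?N}" by (rule ivl_subset[THEN iffD2]) simp
    then have "set is \<subseteq> {1..<?N}" using "is"(1) by (rule subset_trans[rotated])
    then show ?thesis using "is"(2-3) by (rule conclude) (simp only: "is"(4) same[OF u])
  next
    case 2
    define v where "v = u \<circ> simple_refl n"
    have v_apply: "v i = (if i = n then u ?N else if i = ?N then ?N else u i)" for i
      using up 2 by (simp add: v_def simple_refl_apply)
    have "v permutes {1..?N}"
      unfolding v_def using 2 perm by (intro permutes_compose permutes_simple_refl) auto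
    then have v: "v permutes {1..n}" by (rule permutes_Suc_fixed) (simp add: v_apply)
    \<comment> \<open>\<open>v\<close> carries at position \<open>n\<close> the last entry of
      \<open>u\<close>; \<open>\<sigma>\<close> skips the position \<open>n\<close> of the deleted
      largest value.\<close>
    define \<sigma> where "\<sigma> i = (if i = n then ?N else i)" for i
    have "\<sigma> i < \<sigma> j" if "i < j" "j \<le> n" for i j using that by (auto simp: \<sigma>_def)
    moreover have "v i = u (\<sigma> i)" if "i \<le> n" for i using that by (auto simp: \<sigma>_def v_apply)
    ultimately obtain "is" where "is": "set is \<subseteq> {1..<n}" "distinct is" "v = word_prod is"
      "length is = card (inversions {1..n} (pos v))"
      using Suc.IH[OF v avoids_321_3412_transfer[OF v, of \<sigma> u]] Suc.prems(2,3) by auto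
    have uv: "u = v \<circ> simple_refl n" unfolding v_def by (simp only: simple_refl_comp_involutive)
    then have "u = word_prod (is @ [n])" unfolding "is"(3) by simp
    moreover have "card (inversions {1..?N} (pos u)) = Suc (card (inversions {1..?N} (pos v)))"
    proof -
      have "pos u = simple_refl n \<circ> pos v"
        unfolding uv using v by (simp add: o_inv_distrib[OF permutes_bij bij_simple_refl])
      moreover have "card (inversions {1..?N} (simple_refl n \<circ> pos v))
          = Suc (card (inversions {1..?N} (pos v)))"
      proof (rule inversions_position_swap)
        show "bij (pos v)" using v by (intro permutes_bij permutes_inv)
        show "u ?N \<in> {1..?N}" "u ?N < ?N" using mem[of ?N] inj[of ?N n] up 2 by auto
        show "pos v (u ?N) = n" using v v_apply[of n] by (metis permutes_inverses(2))
        show "pos v ?N = n + 1" using v v_apply[of ?N] 2 by (metis permutes_inverses(2) Suc_eq_plus1 n_not_Suc_n)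
      qed simp_all
      ultimately show ?thesis by simp
    qed
    moreover have "set (is @ [n]) \<subseteq> {1..<?N}" "distinct (is @ [n])" "length (is @ [n]) = Suc (length is)"
      using "is"(1,2) 2 by auto
    ultimately show ?thesis
      using "is"(4) same[OF v] by (intro conclude[of "is @ [n]"]) simp_all
  next
    case 3
    have uN: "u ?N = n"
    proof (rule ccontr)
      assume ne: "u ?N \<noteq> n"
      define q where "q = pos u n"
      have uq: "u q = n" unfolding q_def using perm by (simp add: permutes_inverses)
      then have q: "q \<in> {1..?N}" "q \<noteq> ?N" "q \<noteq> p" using mem[of q] 3 ne up by auto
      have uN: "u ?N < n" using upper[of ?N] inj[of ?N p] up 3 ne by auto
      show False
      \<comment> \<open>Left of \<open>p\<close>, the value \<open>n\<close> would form a 3412 with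
        \<open>n + 1\<close> and the last two entries; right of \<open>p\<close>, it would
        contradict the increase after \<open>p\<close>.\<close>
      proof (cases "q < p")
        case True
        have "u n < u ?N" using from_p[of n ?N] 3 by simp
        then show False using Suc.prems(3)[of q p n ?N] True 3 uN up uq by simp
      next
        case False
        then show False using from_p[of q ?N] q uN uq by auto
      qed
    qed
    define v where "v = simple_refl n \<circ> u"
    have v_apply: "v i = (if i = p then n else if i = ?N then ?N else u i)" for i
      using up uN inj[of i p] inj[of i ?N] 3 by (auto simp: v_def simple_refl_apply)
    have "v permutes {1..?N}"
      unfolding v_def using 3 perm by (intro permutes_compose permutes_simple_refl) auto
    moreover have "v ?N = ?N" using 3 by (simp add: v_apply)
    ultimately have v: "v permutes {1..n}" by (rule permutes_Suc_fixed)
    \<comment> \<open>On positions up to \<open>n\<close>, \<open>v\<close> merely lowers the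
      largest value from \<open>n + 1\<close> to \<open>n\<close>, and \<open>n\<close> does not
      occur there in \<open>u\<close>.\<close>
    have "v i < v j \<longleftrightarrow> u i < u j" if "i \<le> n" "j \<le> n" for i j
    proof -
      have "u k < n" if "k \<le> n" "k \<noteq> p" for k
        using upper[of k] inj[of k p] inj[of k ?N] that up uN by auto
      then show ?thesis using that up by (auto simp: v_apply dest: less_imp_not_less intro: less_SucI)
    qed
    then obtain "is" where "is": "set is \<subseteq> {1..<n}" "distinct is" "v = word_prod is"
      "length is = card (inversions {1..n} (pos v))"
      using Suc.IH[OF v avoids_321_3412_transfer[OF v, of "\<lambda>i. i" u]] Suc.prems(2,3) by auto
    have uv: "u = simple_refl n \<circ> v" unfolding v_def by (simp only: simple_refl_comp_involutive)
    then have "u = word_prod (n # is)" unfolding "is"(3) by simp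
    moreover have "card (inversions {1..?N} (pos u)) = Suc (card (inversions {1..?N} (pos v)))"
    proof -
      have "pos v n = p" "pos v ?N = ?N"
        using v v_apply[of p] v_apply[of ?N] 3 by (metis permutes_inverses(2) less_not_refl less_SucI)+
      moreover have "pos u = pos v \<circ> simple_refl n"
        unfolding uv using v by (intro pos_simple_refl_comp permutes_bij)
      ultimately show ?thesis
        using inversions_value_swap[of n "{1..?N}" "pos v"] 3 by simp
    qed
    moreover have "set (n # is) \<subseteq> {1..<?N}" "distinct (n # is)" "length (n # is) = Suc (length is)"
      using "is"(1,2) 3 by auto
    ultimately show ?thesis
      using "is"(4) same[OF v] by (intro conclude[of "n # is"]) simp_all
  qed
qed

subsection \<open>Spherical permutations\<close>

lemma spherical_iff:
  assumes w: "w permutes {1..n}"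
  shows "spherical n w \<longleftrightarrow> (\<exists>is. set is \<subseteq> {1..<n} \<and> word_prod is = w \<and>
    length is = card (inversions {1..n} (pos w)) \<and>
    (\<forall>j \<in> {1..<n} - descents n w. length (filter (\<lambda>i. i = j) is) \<le> 1) \<and>
    (\<forall>a b. 1 \<le> a \<and> a < b \<and> b \<le> n \<and> {a..<b} \<subseteq> descents n w \<and> a - 1 \<notin> descents n w \<and>
       b \<notin> descents n w \<longrightarrow> length (filter (\<lambda>i. i \<in> {a..<b}) is)
         \<le> card {(x, y). x \<in> {a..b} \<and> y \<in> {a..b} \<and> x < y} + (b - a)))"
proof -
  have J: "descents n w \<subseteq> {1..<n}" by (auto simp: descents_def simple_indices_def)
  have components: "(\<forall>C \<in> dynkin_components n (descents n w). P C) \<longleftrightarrow>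
      (\<forall>a b. 1 \<le> a \<and> a < b \<and> b \<le> n \<and> {a..<b} \<subseteq> descents n w \<and> a - 1 \<notin> descents n w \<and>
         b \<notin> descents n w \<longrightarrow> P {a..<b})" for P
    unfolding Ball_def mem_dynkin_components_iff[OF J] by blast
  have "(\<forall>C \<in> dynkin_components n (descents n w).
           length (filter (\<lambda>i. i \<in> C) is) \<le> coxeter_length n (longest_element n C) + card C) \<longleftrightarrow>
    (\<forall>a b. 1 \<le> a \<and> a < b \<and> b \<le> n \<and> {a..<b} \<subseteq> descents n w \<and> a - 1 \<notin> descents n w \<and>
       b \<notin> descents n w \<longrightarrow> length (filter (\<lambda>i. i \<in> {a..<b}) is)
         \<le> card {(x, y). x \<in> {a..b} \<and> y \<in> {a..b} \<and> x < y} + (b - a))" for "is"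
    unfolding components by (simp only: coxeter_length_longest_element card_atLeastLessThan cong: conj_cong imp_cong)
  moreover have letters: "card {t. t < length is \<and> is ! t = j} = length (filter (\<lambda>i. i = j) is)"
    "card {t. t < length is \<and> is ! t \<in> C} = length (filter (\<lambda>i. i \<in> C) is)" for "is" and j :: nat and C
    by (simp_all add: length_filter_conv_card)
  ultimately show ?thesis
    unfolding spherical_def reduced_word_def simple_indices_def coxeter_length_eq[OF w]
      letters by (simp only: conj_assoc)
qed

lemma not_crossing_if_spherical:
  assumes w: "w permutes {1..n}" and "spherical n w"
  shows "\<not> crossing_321 n (pos w) \<and> \<not> crossing_3412 n (pos w)"
proof -
  obtain "is" where "is": "word_prod is = w"
    and once: "\<forall>j \<in> {1..<n} - descents n w. length (filter (\<lambda>i. i = j) is) \<le> 1"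
    and few: "\<forall>a b. 1 \<le> a \<and> a < b \<and> b \<le> n \<and> {a..<b} \<subseteq> descents n w \<and> a - 1 \<notin> descents n w \<and>
       b \<notin> descents n w \<longrightarrow> length (filter (\<lambda>i. i \<in> {a..<b}) is)
         \<le> card {(x, y). x \<in> {a..b} \<and> y \<in> {a..b} \<and> x < y} + (b - a)"
    using assms(2) unfolding spherical_iff[OF w] by blast
  have asc: "pos w k < pos w (k + 1) \<Longrightarrow> k \<notin> descents n w" for k
    by (simp add: mem_descents_iff[OF w])
  have once': "length (filter (\<lambda>j. j = k) is) \<le> 1" if "k \<in> {1..<n}" "pos w k < pos w (k + 1)" for k
    using that asc once by blast
  have few': "length (filter (\<lambda>j. j \<in> {a..<b}) is)
      \<le> card {(u, v). u \<in> {a..b} \<and> v \<in> {a..b} \<and> u < v} + (b - a)"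
    if "1 \<le> a" "a < b" "b < n" "pos w (a - 1) < pos w a" "pos w b < pos w (b + 1)"
      "\<And>i. i \<in> {a..<b} \<Longrightarrow> pos w (i + 1) < pos w i" for a b
  proof -
    have "{a..<b} \<subseteq> descents n w"
      using that(1,3,6) by (auto simp: mem_descents_iff[OF w])
    moreover have "a - 1 \<notin> descents n w" using asc[of "a - 1"] that(1,4) by simp
    moreover have "b \<notin> descents n w" using that(5) by (rule asc)
    ultimately show ?thesis using that(1-3) by (intro few[rule_format] conjI) simp_all
  qed
  have "pos w = pos (word_prod is)" by (simp only: "is")
  then show ?thesis
    using not_crossing_321_if_few_letters[OF once' few'] not_crossing_3412_if_letters_once[OF once']
    by blast
qed

section \<open>A spherical word from the absence of crossings\<close>

lemma less_if_ascents:
  fixes f :: "nat \<Rightarrow> nat"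
  assumes "\<And>k. x \<le> k \<Longrightarrow> k < y \<Longrightarrow> f k < f (k + 1)" "x < y"
  shows "f x < f y"
proof -
  have "f x < f (Suc x + d)" if "Suc x + d \<le> y" for d
    using that
  proof (induction d)
    case 0
    then show ?case using assms(1)[of x] by simp
  next
    case (Suc d)
    then show ?case using assms(1)[of "Suc x + d"] by simp
  qed
  from this[of "y - Suc x"] show ?thesis using assms(2) by simp
qed

lemma spherical_if_not_crossing:
  assumes w: "w permutes {1..n}"
    and no321: "\<not> crossing_321 n (pos w)" and no3412: "\<not> crossing_3412 n (pos w)"
  shows "spherical n w"
proof -
  let ?J = "descents n w"
  have J: "?J \<subseteq> {1..<n}" by (auto simp: descents_def simple_indices_def)
  from parabolic_factorization[OF J w] obtain ds u where ds: "set ds \<subseteq> ?J" "w = word_prod ds \<circ> u"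
    and u: "u permutes {1..n}" and u_asc: "\<forall>i \<in> ?J. pos u i < pos u (i + 1)"
    and counts: "\<forall>a b. 1 \<le> a \<longrightarrow> a - 1 \<notin> ?J \<longrightarrow> b \<notin> ?J \<longrightarrow>
       length (filter (\<lambda>i. i \<in> {a..<b}) ds) + card (inversions {a..b} (pos u))
         = card (inversions {a..b} (pos w))"
    by blast
  have pos_w: "pos w (w i) = i" and pos_u: "pos u (u i) = i" for i
    using w u by (simp_all add: permutes_inverses)
  have mem_w: "w i \<in> {1..n} \<longleftrightarrow> i \<in> {1..n}" for i
    using w by (rule permutes_in_image)
  have mem_u: "u i \<in> {1..n} \<longleftrightarrow> i \<in> {1..n}" for i
    using u by (rule permutes_in_image)
  \<comment> \<open>An inversion of \<open>u\<close> must pass a boundary \<open>k\<close> outside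
    \<open>J\<close>. No letter of \<open>ds\<close> equals \<open>k\<close>, so \<open>w\<close>
    and \<open>u\<close> have the same entries on each side of \<open>k\<close>, and the boundary
    carries over to \<open>w\<close>.\<close>
  have separated: "\<exists>k. u i \<le> k \<and> k < u j \<and> pos w k < pos w (k + 1) \<and> (\<forall>v. w v \<le> k \<longleftrightarrow> u v \<le> k)"
    if "i \<in> {1..n}" "j \<in> {1..n}" and less: "u i < u j" and "j < i" for i j
  proof -
    have "\<not> pos u (u i) < pos u (u j)" using that(4) unfolding pos_u by simp
    then obtain k where k: "u i \<le> k" "k < u j" "\<not> pos u k < pos u (k + 1)"
      using less_if_ascents[of "u i" "u j" "pos u"] less by blast
    then have "k \<notin> ?J" using u_asc by blast
    moreover from this have "k \<notin> set ds" using ds(1) by blast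
    then have "\<forall>v. w v \<le> k \<longleftrightarrow> u v \<le> k"
      unfolding ds(2) comp_def by (intro allI word_prod_le_iff)
    moreover have "k \<in> {1..<n}" using k mem_u[of i] mem_u[of j] that(1,2) by auto
    moreover have "pos w k \<noteq> pos w (k + 1)"
      using permutes_inj[OF permutes_inv[OF w]] by (metis injD n_not_Suc_n Suc_eq_plus1)
    ultimately show ?thesis
      using k(1,2) by (intro exI[of _ k]) (auto simp: mem_descents_iff[OF w])
  qed
  have u321: "\<not> (u k < u j \<and> u j < u i)" if ij: "i < j" and jk: "j < k" for i j k
  proof
    assume "u k < u j \<and> u j < u i"
    then have *: "u k < u j" "u j < u i" by simp_all
    then have "1 \<le> i" "k \<le> n" using permutes_inversion_bound[OF u, of i k] that by simp_all
    then have mem: "i \<in> {1..n}" "j \<in> {1..n}" "k \<in> {1..n}" using that by simp_all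
    obtain a where a: "u k \<le> a" "a < u j" "pos w a < pos w (a + 1)"
      and iff_a: "\<And>v. w v \<le> a \<longleftrightarrow> u v \<le> a"
      using separated[OF mem(3,2) *(1) jk] by blast
    obtain b where b: "u j \<le> b" "b < u i" "pos w b < pos w (b + 1)"
      and iff_b: "\<And>v. w v \<le> b \<longleftrightarrow> u v \<le> b"
      using separated[OF mem(2,1) *(2) ij] by blast
    have "w k \<le> a" "a < w j" "w j \<le> b" "b < w i"
      using a(1,2) b(1,2) by (simp_all add: iff_a iff_b flip: not_le)
    then have "crossing_321 n (pos w)"
      using crossing_321I[of "w k" a "a + 1" "w j" b "b + 1" "w i" n "pos w"]
        a(3) b(3) ij jk mem_w[of k] mem_w[of i] mem by (simp add: pos_w)
    then show False using no321 by contradiction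
  qed
  have u3412: "\<not> (u k < u l \<and> u l < u i \<and> u i < u j)" if ij: "i < j" and jk: "j < k" and kl: "k < l" for i j k l
  proof
    assume "u k < u l \<and> u l < u i \<and> u i < u j"
    then have *: "u k < u l" "u l < u i" "u i < u j" by simp_all
    then have "1 \<le> i" "l \<le> n" using permutes_inversion_bound[OF u, of i l] that by simp_all
    then have mem: "i \<in> {1..n}" "j \<in> {1..n}" "k \<in> {1..n}" "l \<in> {1..n}" using that by simp_all
    obtain a where a: "u l \<le> a" "a < u i" "pos w a < pos w (a + 1)"
      and iff: "\<And>v. w v \<le> a \<longleftrightarrow> u v \<le> a"
      using separated[OF mem(4,1) *(2)] ij jk kl by auto
    have le: "w k \<le> a" "w l \<le> a" "\<not> w i \<le> a" "\<not> w j \<le> a"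
      unfolding iff using a(1,2) * by simp_all
    \<comment> \<open>The factor \<open>ds\<close> may reorder the values within each of the two
      pairs; \<open>crossing_3412\<close> leaves that order open, hence \<open>min\<close> and
      \<open>max\<close>.\<close>
    have "w k \<noteq> w l" "w i \<noteq> w j"
      using that permutes_inj[OF w] by (auto dest: injD)
    then have "min (w k) (w l) < max (w k) (w l)" "min (w i) (w j) < max (w i) (w j)"
      by linarith+
    moreover have "1 \<le> min (w k) (w l)" "max (w i) (w j) \<le> n"
      using mem_w[of k] mem_w[of l] mem_w[of i] mem_w[of j] mem by auto
    moreover have "max (w k) (w l) \<le> a" "a + 1 \<le> min (w i) (w j)"
      using le by auto
    moreover have "pos w v < pos w v'" if "v \<in> {w i, w j}" "v' \<in> {w k, w l}" for v v'
      using that ij jk kl by (auto simp: pos_w)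
    then have "pos w (min (w i) (w j)) < pos w (min (w k) (w l))"
      "pos w (min (w i) (w j)) < pos w (max (w k) (w l))"
      "pos w (max (w i) (w j)) < pos w (min (w k) (w l))"
      "pos w (max (w i) (w j)) < pos w (max (w k) (w l))"
      by (simp_all add: min_def max_def)
    ultimately have "crossing_3412 n (pos w)"
      using a(3) by (intro crossing_3412I[where x = a and y = "a + 1"]) (assumption | simp only: less_add_one)+
    then show False using no3412 by contradiction
  qed
  obtain es where es: "set es \<subseteq> {1..<n}" "distinct es" "u = word_prod es"
      "length es = card (inversions {1..n} (pos u))"
    using distinct_word_if_avoids_321_3412[OF u u321 u3412] by blast
  have once: "length (filter (\<lambda>i. i = j) es) \<le> 1" for j
  proof -
    have "length (filter (\<lambda>i. i = j) es) = card (set (filter (\<lambda>i. i = j) es))"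
      using es(2) by (intro distinct_card[symmetric] distinct_filter)
    also have "\<dots> \<le> card {j}" by (rule card_mono) auto
    finally show ?thesis by simp
  qed
  show ?thesis
    unfolding spherical_iff[OF w]
  \<comment> \<open>The concatenation is reduced because the counts for \<open>{1..n}\<close> add up
    to the inversions of \<open>w\<close>.\<close>
  proof (intro exI[of _ "ds @ es"] conjI ballI allI impI)
    show "set (ds @ es) \<subseteq> {1..<n}" using ds(1) J es(1) by auto
    show "word_prod (ds @ es) = w" unfolding ds(2) es(3) by simp
    have "filter (\<lambda>i. i \<in> {1..<n}) ds = ds" using ds(1) J by (intro filter_True) auto
    moreover have "0 \<notin> ?J" "n \<notin> ?J" using J by auto
    ultimately have "length ds + card (inversions {1..n} (pos u)) = card (inversions {1..n} (pos w))"
      using counts[rule_format, of 1 n] by simp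
    then show "length (ds @ es) = card (inversions {1..n} (pos w))" using es(4) by simp
  next
    fix j assume "j \<in> {1..<n} - ?J"
    then have "filter (\<lambda>i. i = j) ds = []" using ds(1) by (auto simp: filter_empty_conv)
    then show "length (filter (\<lambda>i. i = j) (ds @ es)) \<le> 1" using once[of j] by simp
  next
    \<comment> \<open>In a block, \<open>ds\<close> uses at most one letter per pair of values,
      which amounts to the length of the longest element, and the distinct letters of
      \<open>es\<close> add at most \<open>b - a\<close>, the size of the component.\<close>
    fix a b assume ab: "1 \<le> a \<and> a < b \<and> b \<le> n \<and> {a..<b} \<subseteq> ?J \<and> a - 1 \<notin> ?J \<and> b \<notin> ?J"
    let ?P = "{(x, y). x \<in> {a..b} \<and> y \<in> {a..b} \<and> x < y}"
    have "finite ?P" by (rule finite_subset[of _ "{a..b} \<times> {a..b}"]) auto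
    then have "card (inversions {a..b} (pos w)) \<le> card ?P"
      by (rule card_mono) (auto simp: inversions_def)
    then have "length (filter (\<lambda>i. i \<in> {a..<b}) ds) \<le> card ?P"
      using counts[rule_format, of a b] ab by simp
    moreover have "length (filter (\<lambda>i. i \<in> {a..<b}) es) \<le> b - a"
    proof -
      have "length (filter (\<lambda>i. i \<in> {a..<b}) es) = card (set (filter (\<lambda>i. i \<in> {a..<b}) es))"
        using es(2) by (intro distinct_card[symmetric] distinct_filter)
      also have "\<dots> \<le> card {a..<b}" by (rule card_mono) auto
      finally show ?thesis by simp
    qed
    ultimately show "length (filter (\<lambda>i. i \<in> {a..<b}) (ds @ es)) \<le> card ?P + (b - a)" by simp
  qed
qed

theorem theorem1p5:
  fixes n :: nat and w :: "nat \<Rightarrow> nat"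
  assumes "n \<ge> 1" and "w permutes {1..n}"
  shows "spherical n w \<longleftrightarrow> (\<forall>p \<in> spherical_patterns. avoids n w p)"
  unfolding avoids_spherical_patterns_iff[OF assms(2)]
  using not_crossing_if_spherical[OF assms(2)] spherical_if_not_crossing[OF assms(2)] by blast

end
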